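(* Let $c>0$, $c\ne 1$, $\gamma\ge 0$, $\gamma+\beta>0$ and $x$ be real. Then for all complex $t$ with $|t|<\min\{1,c^{-1}\}$, $$\sum_{n=0}^{+\infty}\frac{(c\,t)^n}{(\gamma+\beta)_n}\mathscr{M}_n(x;\beta,c,\gamma)=(1-c\,t)^{-1}F_1\left[1,\gamma,-x;\gamma+\beta;\,t,\ \frac{t(1-c)}{1-ct}\right].$$ In particular, if $\beta>0$ and $M_n(x;\beta,c)=\mathscr{M}_n(x;\beta,c,0)$ denotes the Meixner polynomials, then for $|t|<\min\{1,c\}$ $$\sum_{n=0}^{+\infty}\frac{t^n}{(\beta)_n}M_n(x;\beta,c)=(1-t)^{-1}{}_2F_1\left(\begin{array}{c}1,\ -x\\ \beta\end{array}\Big|\,\frac{t(1-c)}{c(1-t)}\right).$$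
   Context: The associated Meixner polynomials $\mathscr{M}_n(x;\beta,c,\gamma)$ are defined by $\mathscr{M}_{-1}=0$, $\mathscr{M}_0=1$ and, for $n\ge 0$, $$c\,\mathscr{M}_{n+1}(x;\beta,c,\gamma)=[(c-1)x+(c+1)(n+\gamma)+\beta c]\,\mathscr{M}_n(x;\beta,c,\gamma)-(n+\gamma)(n+\gamma+\beta-1)\,\mathscr{M}_{n-1}(x;\beta,c,\gamma).$$ For $\gamma=0$ (and $\beta>0$) one has $M_n(x;\beta,c)=(\beta)_n\,{}_2F_1(-n,-x;\beta;1-\frac1c)$. Pochhammer symbol: $(a)_0=1$, $(a)_k=a(a+1)\cdots(a+k-1)$. The first Appell function is $$F_1[\alpha,\beta_1,\beta_2;\sigma;X,Y]=\sum_{m,n\ge0}\frac{(\alpha)_{m+n}(\beta_1)_m(\beta_2)_n}{(\sigma)_{m+n}}\frac{X^m}{m!}\frac{Y^n}{n!}=\sum_{m\ge0}\frac{(\alpha)_m(\beta_1)_m}{(\sigma)_m}\,{}_2F_1\left(\begin{array}{c}\alpha+m,\ \beta_2\\ \sigma+m\end{array}\Big|Y\right)\frac{X^m}{m!}$$ for $\max\{|X|,|Y|\}<1$; when $|X|<1$ but $|Y|\ge 1$, $Y\notin[1,\infty)$, it is understood by analytic continuation in $Y$ (i.e. via the second expression with ${}_2F_1$ denoting the principal branch on $\mathbb{C}\setminus[1,\infty)$). *)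

theory Defs
  imports "HOL-Complex_Analysis.Complex_Analysis"
begin

text \<open>
  The recurrence starts from \<open>M\<^sub>-\<^sub>1 = 0\<close>, \<open>M\<^sub>0 = 1\<close>; the second equation is its instance at
  \<open>n = 0\<close>, where the \<open>M\<^sub>-\<^sub>1\<close> term vanishes. Intended for \<open>c \<noteq> 0\<close>.
\<close>

fun assoc_meixner :: "nat \<Rightarrow> real \<Rightarrow> real \<Rightarrow> real \<Rightarrow> real \<Rightarrow> real" where
  "assoc_meixner 0 x \<beta> c \<gamma> = 1"
| "assoc_meixner (Suc 0) x \<beta> c \<gamma> = ((c - 1) * x + (c + 1) * \<gamma> + \<beta> * c) / c"
| "assoc_meixner (Suc (Suc n)) x \<beta> c \<gamma> =
     (((c - 1) * x + (c + 1) * (real (Suc n) + \<gamma>) + \<beta> * c) * assoc_meixner (Suc n) x \<beta> c \<gamma>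
       - (real (Suc n) + \<gamma>) * (real (Suc n) + \<gamma> + \<beta> - 1) * assoc_meixner n x \<beta> c \<gamma>) / c"

definition meixner :: "nat \<Rightarrow> real \<Rightarrow> real \<Rightarrow> real \<Rightarrow> real" where
  "meixner n x \<beta> c = assoc_meixner n x \<beta> c 0"

text \<open>
  The principal branch of the Gauss function: the analytic continuation of the hypergeometric
  series from the unit disc to the plane cut along \<open>[1, \<infinity>)\<close>. The continuation is unique on the
  cut plane by the identity theorem; the values on the cut itself are unspecified.
\<close>

definition hyp2f1 :: "complex \<Rightarrow> complex \<Rightarrow> complex \<Rightarrow> complex \<Rightarrow> complex" where
  "hyp2f1 a b s =
     (SOME f. f holomorphic_on (- complex_of_real ` {1..}) \<and>
              (\<forall>z\<in>ball 0 1. f z = eval_fps (fps_hypergeo [a, b] [s] 1) z))"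

text \<open>
  The first Appell function: the double series on the bidisc, and otherwise the continuation in
  \<open>Y\<close> through the expansion in powers of \<open>X\<close>. Meaningful for \<open>\<bar>X\<bar> < 1\<close> and \<open>Y \<notin> [1, \<infinity>)\<close>.
\<close>

definition appell_F1 ::
  "complex \<Rightarrow> complex \<Rightarrow> complex \<Rightarrow> complex \<Rightarrow> complex \<Rightarrow> complex \<Rightarrow> complex" where
  "appell_F1 a b1 b2 s X Y =
     (if max (norm X) (norm Y) < 1 then
        (\<Sum>\<^sub>\<infinity>(m, n)\<in>UNIV. pochhammer a (m + n) * pochhammer b1 m * pochhammer b2 n
            / pochhammer s (m + n) * (X ^ m / fact m) * (Y ^ n / fact n))
      else
        (\<Sum>m. pochhammer a m * pochhammer b1 m / pochhammer s m
            * hyp2f1 (a + of_nat m) b2 (s + of_nat m) Y * (X ^ m / fact m)))"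

end

theory Submission
  imports Defs
begin

text \<open>
  Put \<open>s = \<gamma> + \<beta>\<close> and \<open>Y(t) = t (1 - c) / (1 - c t)\<close>. The Gauss functions
  \<open>g\<^sub>m = \<^sub>2F\<^sub>1(1 + m, -x; s + m; \<cdot>)\<close> are continued to the cut plane by
  Euler's integral for the lower parameter \<open>s + 2 + m\<close>, followed by two applications of
  \<open>f + z f' / \<sigma>\<close>, which lowers that parameter from \<open>\<sigma> + 1\<close> to \<open>\<sigma>\<close>. This also bounds
  all \<open>g\<^sub>m\<close> at once, locally uniformly, so that
  \<open>H(t) = \<Sum>\<^sub>m (\<gamma>)\<^sub>m / (s)\<^sub>m g\<^sub>m(Y(t)) t\<^sup>m\<close> is holomorphic for \<open>\<bar>t\<bar> < min 1 (1 / c)\<close>.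
  A contiguous relation between \<open>g\<^sub>m\<close> and \<open>g\<^sub>m\<^sub>+\<^sub>1\<close> yields
  \<open>t (1 - t) H' + (s - 1 - \<gamma> t + x Y) H = s - 1\<close>, and for the Taylor coefficients of
  \<open>H / (1 - c t)\<close> this equation is the recurrence of the polynomials.
\<close>

subsection \<open>The cut plane and locally bounded families\<close>

definition cut_plane :: "complex set" where
  "cut_plane = - complex_of_real ` {1..}"

lemma open_cut_plane: "open cut_plane"
proof -
  have "complex_of_real ` {1..} = \<real> \<inter> {z. Re z \<ge> 1}"
    by (force simp: complex_is_Real_iff complex_eq_iff)
  then have "closed (complex_of_real ` {1..})"
    by (simp add: closed_Int closed_complex_Reals closed_halfspace_Re_ge)
  then show ?thesis
    by (simp add: cut_plane_def open_Compl)
qed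

text \<open>If z u = r >= 1 with 0 < u <= 1, then z = r / u is itself on the cut. This keeps Euler's
  kernel off its branch cut for all u in [0, 1], and makes the cut plane star-shaped about
  0.\<close>

lemma cut_plane_mult:
  assumes "z \<in> cut_plane" "0 \<le> u" "u \<le> 1"
  shows "z * of_real u \<in> cut_plane"
  unfolding cut_plane_def
proof
  assume "z * of_real u \<in> complex_of_real ` {1..}"
  then obtain r where r: "z * of_real u = of_real r" "r \<ge> 1"
    by auto
  then have "u \<noteq> 0"
    by auto
  with r have z: "z = of_real (r / u)"
    by (simp add: field_simps)
  moreover have "r / u \<in> {1..}"
    using r assms \<open>u \<noteq> 0\<close> by (simp add: field_simps)
  ultimately show False
    using assms(1) unfolding cut_plane_def z by blast
qed

lemma zero_in_cut_plane: "0 \<in> cut_plane"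
  by (auto simp: cut_plane_def)

lemma connected_cut_plane: "connected cut_plane"
proof -
  have "starlike cut_plane"
    unfolding starlike_def
  proof (intro bexI ballI subsetI)
    fix z w assume "z \<in> cut_plane" "w \<in> closed_segment 0 z"
    then show "w \<in> cut_plane"
      using cut_plane_mult[of z] by (auto simp: in_segment scaleR_conv_of_real mult.commute)
  qed (rule zero_in_cut_plane)
  then show ?thesis
    by (rule starlike_imp_connected)
qed

lemma unit_ball_subset_cut_plane: "ball 0 1 \<subseteq> cut_plane"
  by (auto simp: cut_plane_def)

text \<open>Places 1 - z where the principal branch of \<open>powr\<close> is holomorphic.\<close>

lemma one_minus_not_nonpos:
  assumes "z \<in> cut_plane"
  shows "1 - z \<notin> \<real>\<^sub>\<le>\<^sub>0"
proof
  assume "1 - z \<in> \<real>\<^sub>\<le>\<^sub>0"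
  then obtain r where r: "1 - z = of_real r" "r \<le> 0"
    by (auto elim!: nonpos_Reals_cases)
  then have z: "z = of_real (1 - r)"
    by (simp add: algebra_simps)
  have "1 - r \<in> {1..}"
    using r by simp
  with assms show False
    unfolding cut_plane_def z by blast
qed

text \<open>The bound \<open>K\<close> must serve all indices at once: it later supplies a summable
  majorant for a series whose terms contain the functions \<open>f m\<close>.\<close>

definition locally_bounded_family :: "(nat \<Rightarrow> complex \<Rightarrow> complex) \<Rightarrow> complex set \<Rightarrow> bool" where
  "locally_bounded_family f D \<longleftrightarrow>
     (\<forall>z\<in>D. \<exists>r>0. \<exists>K. ball z r \<subseteq> D \<and> (\<forall>m. \<forall>w\<in>ball z r. norm (f m w) \<le> K))"

lemma locally_bounded_familyE:
  assumes "locally_bounded_family f D" "z \<in> D"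
  obtains r K where "r > 0" "ball z r \<subseteq> D" "\<And>m w. w \<in> ball z r \<Longrightarrow> norm (f m w) \<le> K"
  using assms unfolding locally_bounded_family_def by metis

text \<open>Cauchy's inequality on discs of radius r/2 about the points of the half-size ball; the
  resulting bound K / (r/2) is again independent of the index.\<close>

lemma locally_bounded_family_deriv:
  assumes lb: "locally_bounded_family f D" and hol: "\<And>m. f m holomorphic_on D"
  shows "locally_bounded_family (\<lambda>m. deriv (f m)) D"
  unfolding locally_bounded_family_def
proof
  fix z assume "z \<in> D"
  then obtain r K where r: "r > 0" "ball z r \<subseteq> D"
      and K: "\<And>m w. w \<in> ball z r \<Longrightarrow> norm (f m w) \<le> K"
    using locally_bounded_familyE[OF lb] by metis
  have "norm (deriv (f m) w) \<le> K / (r/2)" if w: "w \<in> ball z (r/2)" for m w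
  proof -
    have sub: "cball w (r/2) \<subseteq> ball z r"
    proof
      fix v assume "v \<in> cball w (r/2)"
      then have "dist z v < r/2 + r/2"
        using w dist_triangle[of z v w] by (simp add: dist_commute)
      then show "v \<in> ball z r" by simp
    qed
    have hol': "f m holomorphic_on cball w (r/2)"
      using hol holomorphic_on_subset sub r by blast
    have "norm ((deriv ^^ 1) (f m) w) \<le> fact 1 * K / (r/2) ^ 1"
    proof (rule Cauchy_inequality)
      show "f m holomorphic_on ball w (r/2)"
        using hol' by (rule holomorphic_on_subset) auto
      show "continuous_on (cball w (r/2)) (f m)"
        using hol' by (rule holomorphic_on_imp_continuous_on)
      show "norm (f m x) \<le> K" if "norm (w - x) = r/2" for x
        using that sub by (intro K) (auto simp: dist_norm subset_iff)
    qed (use r in auto)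
    then show ?thesis by simp
  qed
  moreover have "ball z (r/2) \<subseteq> D"
    using r subset_ball[of "r/2" r z] by auto
  ultimately show "\<exists>r>0. \<exists>K. ball z r \<subseteq> D \<and> (\<forall>m. \<forall>w\<in>ball z r. norm (deriv (f m) w) \<le> K)"
    using r half_gt_zero by blast
qed

text \<open>The operator f + a z f' lowers the third parameter of a Gauss function when a = 1 /
  \<sigma>. Bounded factors \<open>a m\<close> preserve local boundedness, since z and f' are
  locally bounded.\<close>

lemma locally_bounded_family_lower:
  assumes lb: "locally_bounded_family f D" and hol: "\<And>m. f m holomorphic_on D"
    and "\<And>m. norm (a m) \<le> A"
  shows "locally_bounded_family (\<lambda>m z. f m z + a m * (z * deriv (f m) z)) D"
  unfolding locally_bounded_family_def
proof
  fix z assume z: "z \<in> D"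
  obtain r1 K1 where 1: "r1 > 0" "ball z r1 \<subseteq> D"
      "\<And>m w. w \<in> ball z r1 \<Longrightarrow> norm (f m w) \<le> K1"
    using locally_bounded_familyE[OF lb z] by metis
  obtain r2 K2 where 2: "r2 > 0" "ball z r2 \<subseteq> D"
      "\<And>m w. w \<in> ball z r2 \<Longrightarrow> norm (deriv (f m) w) \<le> K2"
    using locally_bounded_familyE[OF locally_bounded_family_deriv[OF lb hol] z] by metis
  define r where "r = min r1 r2"
  have "norm (f m w + a m * (w * deriv (f m) w)) \<le> K1 + A * ((norm z + r) * K2)"
    if w: "w \<in> ball z r" for m w
  proof -
    have "norm w \<le> norm z + r"
      using w norm_triangle_sub[of w z] by (simp add: dist_norm norm_minus_commute)
    moreover have "norm (deriv (f m) w) \<le> K2" "norm (f m w) \<le> K1"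
      using w 1 2 by (auto simp: r_def)
    moreover have "norm (f m w + a m * (w * deriv (f m) w))
        \<le> norm (f m w) + norm (a m) * (norm w * norm (deriv (f m) w))"
      by (metis norm_mult norm_triangle_ineq)
    moreover have "A \<ge> 0"
      using assms(3)[of 0] norm_ge_zero order_trans by blast
    moreover have "norm w * norm (deriv (f m) w) \<le> (norm z + r) * K2"
      using calculation order_trans[OF norm_ge_zero calculation(1)] by (intro mult_mono) auto
    moreover have "norm (a m) * (norm w * norm (deriv (f m) w)) \<le> A * ((norm z + r) * K2)"
      using calculation assms(3) by (intro mult_mono[of "norm (a m)" A]) auto
    ultimately show ?thesis by linarith
  qed
  moreover have "r > 0" "ball z r \<subseteq> D"
    using 1 2 by (auto simp: r_def)
  ultimately show "\<exists>r>0. \<exists>K. ball z r \<subseteq> D \<and>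
      (\<forall>m. \<forall>w\<in>ball z r. norm (f m w + a m * (w * deriv (f m) w)) \<le> K)"
    by blast
qed

subsection \<open>Euler's integral\<close>

text \<open>Iterates B(x + 1, y) = x / (x + y) B(x, y). The quotient of Pochhammer symbols is the
  one in the Gauss coefficients.\<close>

lemma Beta_add_nat_left:
  fixes x y :: real
  assumes "x > 0" "y > 0"
  shows "Beta (x + of_nat n) y = Beta x y * pochhammer x n / pochhammer (x + y) n"
proof (induction n)
  case (Suc n)
  have "x + of_nat n \<notin> \<int>\<^sub>\<le>\<^sub>0"
    using assms by (auto elim!: nonpos_Ints_cases)
  from Beta_plus1_left[OF this, of y]
  have "Beta (x + of_nat (Suc n)) y = (x + of_nat n) * Beta (x + of_nat n) y / (x + y + of_nat n)"
    using assms by (simp add: field_simps)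
  then show ?case
    by (simp add: Suc.IH pochhammer_Suc)
qed auto

text \<open>Two units above \<open>\<sigma>\<close>, the weight \<open>(1 - u)\<^sup>\<sigma>\<close> of Euler's integral is continuous on \<open>[0, 1]\<close>.\<close>

definition euler_int :: "real \<Rightarrow> complex \<Rightarrow> nat \<Rightarrow> complex \<Rightarrow> complex" where
  "euler_int \<sigma> b m z =
     integral {0..1} (\<lambda>u. of_real (u ^ m * (1 - u) powr \<sigma>) * (1 - z * of_real u) powr (- b))
       / of_real (Beta (real m + 1) (\<sigma> + 1))"

context
  fixes \<sigma> :: real and b :: complex
  assumes \<sigma>: "\<sigma> > 0"
begin

lemma Beta_pos: "Beta (real m + 1) (\<sigma> + 1) > 0"
  using \<sigma> by (simp add: Beta_def)

lemma has_integral_weight: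
  "((\<lambda>u. u ^ m * (1 - u) powr \<sigma>) has_integral Beta (real m + 1) (\<sigma> + 1)) {0..1}"
proof -
  have "((\<lambda>u. u powr (real m + 1 - 1) * (1 - u) powr (\<sigma> + 1 - 1)) has_integral
           Beta (real m + 1) (\<sigma> + 1)) {0..1}"
    using \<sigma> by (intro has_integral_Beta_real) auto
  \<comment> \<open>For m = 0 the integrands differ at u = 0, where \<open>0 powr 0\<close> is 0 but
    \<open>0 ^ 0\<close> is 1; a single point does not affect the integral.\<close>
  then show ?thesis
    by (rule has_integral_spike[of "{0}", rotated 2]) (auto simp: powr_realpow)
qed

lemma continuous_on_weight:
  "continuous_on {0..1} (\<lambda>u::real. u ^ m * (1 - u) powr \<sigma>)"
  using \<sigma> by (intro continuous_intros continuous_on_powr') auto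

text \<open>Joint continuity serves both differentiation under the integral and the compactness
  bound that is uniform in u.\<close>

lemma continuous_on_kernel:
  assumes "U \<subseteq> cut_plane"
  shows "continuous_on (U \<times> {0..1}) (\<lambda>(z, u). (1 - z * complex_of_real u) powr a)"
proof -
  have *: "1 - fst p * of_real (snd p) \<notin> \<real>\<^sub>\<le>\<^sub>0" if "p \<in> U \<times> {0..1}" for p :: "complex \<times> real"
    using that assms by (intro one_minus_not_nonpos cut_plane_mult) auto
  then show ?thesis
    unfolding case_prod_unfold
    by (intro continuous_on_powr_complex continuous_intros subsetI)
       (use * in \<open>force simp: complex_nonpos_Reals_iff\<close>, use * in force)
qed

lemma continuous_on_kernel1:
  assumes "z \<in> cut_plane"
  shows "continuous_on {0..1} (\<lambda>u. (1 - z * complex_of_real u) powr a)"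
proof -
  have "continuous_on {0..1} ((\<lambda>(z, u). (1 - z * complex_of_real u) powr a) \<circ> (\<lambda>u. (z, u)))"
    using assms
    by (intro continuous_on_compose continuous_on_subset[OF continuous_on_kernel[of "{z}"]])
       (auto intro!: continuous_intros)
  then show ?thesis by (simp add: o_def)
qed

text \<open>Differentiation under the integral asks for a convex domain, and the cut plane is not
  convex. It is therefore carried out on balls, and the local results are glued through
  analyticity.\<close>

lemma euler_int_holomorphic: "euler_int \<sigma> b m holomorphic_on cut_plane"
proof -
  have "(\<lambda>z. integral (cbox 0 1) (\<lambda>u. of_real (u ^ m * (1 - u) powr \<sigma>) *
            (1 - z * of_real u) powr (- b))) holomorphic_on ball w r"
    if sub: "ball w r \<subseteq> cut_plane" for w r
  proof (rule leibniz_rule_holomorphic)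
    fix z and u :: real assume z: "z \<in> ball w r" and u: "u \<in> cbox 0 1"
    have "1 - z * of_real u \<notin> \<real>\<^sub>\<le>\<^sub>0"
      using that z u by (intro one_minus_not_nonpos cut_plane_mult) auto
    then show "((\<lambda>z. of_real (u ^ m * (1 - u) powr \<sigma>) * (1 - z * of_real u) powr (- b))
        has_field_derivative of_real (u ^ m * (1 - u) powr \<sigma>) *
          ((1 - z * of_real u) powr (- b - 1) * (b * of_real u))) (at z within ball w r)"
      by (auto intro!: derivative_eq_intros)
  next
    fix z assume "z \<in> ball w r"
    then have "continuous_on {0..1} (\<lambda>u. of_real (u ^ m * (1 - u) powr \<sigma>) *
            (1 - z * of_real u) powr (- b))"
      using sub by (intro continuous_on_mult continuous_on_of_real continuous_on_weight
           continuous_on_kernel1) auto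
    then show "(\<lambda>u. of_real (u ^ m * (1 - u) powr \<sigma>) * (1 - z * of_real u) powr (- b))
        integrable_on cbox 0 1"
      by (simp add: integrable_continuous_interval)
  next
    have 1: "continuous_on (ball w r \<times> {0..1}) (\<lambda>p. of_real (snd p ^ m * (1 - snd p) powr \<sigma>) :: complex)"
      by (intro continuous_on_of_real continuous_on_compose2[OF continuous_on_weight] continuous_intros) auto
    have 2: "continuous_on (ball w r \<times> {0..1}) (\<lambda>p. (1 - fst p * of_real (snd p)) powr (- b - 1))"
      using continuous_on_kernel[OF sub] by (simp add: case_prod_unfold)
    show "continuous_on (ball w r \<times> cbox 0 1) (\<lambda>(z, u). of_real (u ^ m * (1 - u) powr \<sigma>) *
          ((1 - z * of_real u) powr (- b - 1) * (b * of_real u)))"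
      unfolding case_prod_unfold cbox_interval
      by (intro continuous_on_mult 1 2 continuous_on_const continuous_on_of_real
          continuous_on_snd continuous_on_id)
  qed auto
  then have "euler_int \<sigma> b m holomorphic_on ball w r" if "ball w r \<subseteq> cut_plane" for w r
    unfolding euler_int_def using that Beta_pos[of m]
    by (auto intro!: holomorphic_intros)
  then have "euler_int \<sigma> b m analytic_on cut_plane"
    unfolding analytic_on_def using open_cut_plane open_contains_ball by blast
  then show ?thesis
    by (rule analytic_imp_holomorphic)
qed

text \<open>The weight divided by the Beta value is a probability density on [0, 1]. So
  \<open>euler_int\<close> is an average of the kernel, bounded by the maximum of the kernel over a
  compact set that does not involve m.\<close>

lemma euler_int_locally_bounded: "locally_bounded_family (euler_int \<sigma> b) cut_plane"
  unfolding locally_bounded_family_def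
proof
  fix z assume "z \<in> cut_plane"
  then obtain r where r: "r > 0" "cball z r \<subseteq> cut_plane"
    using open_cut_plane open_contains_cball by blast
  have "compact ((\<lambda>(z, u). (1 - z * complex_of_real u) powr (- b)) ` (cball z r \<times> {0..1}))"
    by (intro compact_continuous_image continuous_on_kernel r compact_Times) auto
  then obtain K where "\<forall>x\<in>(\<lambda>(z, u). (1 - z * complex_of_real u) powr (- b)) ` (cball z r \<times> {0..1}). norm x \<le> K"
    using compact_imp_bounded bounded_iff by blast
  then have K: "norm ((1 - w * complex_of_real u) powr (- b)) \<le> K"
    if "w \<in> cball z r" "u \<in> {0..1}" for w u
    using that by force
  have "norm (euler_int \<sigma> b m w) \<le> K" if w: "w \<in> ball z r" for m w
  proof -
    have "norm (integral {0..1} (\<lambda>u. of_real (u ^ m * (1 - u) powr \<sigma>) * (1 - w * of_real u) powr (- b)))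
       \<le> integral {0..1} (\<lambda>u. (u ^ m * (1 - u) powr \<sigma>) * K)"
    proof (rule integral_norm_bound_integral)
      show "(\<lambda>u. of_real (u ^ m * (1 - u) powr \<sigma>) * (1 - w * of_real u) powr (- b)) integrable_on {0..1}"
        using w r by (intro integrable_continuous_interval continuous_on_mult continuous_on_of_real
            continuous_on_weight continuous_on_kernel1) auto
      show "(\<lambda>u. (u ^ m * (1 - u) powr \<sigma>) * K) integrable_on {0..1}"
        by (intro integrable_continuous_interval continuous_on_mult
            continuous_on_weight continuous_intros)
      show "norm (of_real (u ^ m * (1 - u) powr \<sigma>) * (1 - w * of_real u) powr (- b))
          \<le> (u ^ m * (1 - u) powr \<sigma>) * K" if "u \<in> {0..1}" for u
      proof -
        have "norm (complex_of_real (u ^ m * (1 - u) powr \<sigma>)) = u ^ m * (1 - u) powr \<sigma>"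
          using that by (simp del: of_real_mult)
        then show ?thesis
          unfolding norm_mult using that w by (auto intro!: mult_left_mono K)
      qed
    qed
    also have "\<dots> = Beta (real m + 1) (\<sigma> + 1) * K"
      using has_integral_mult_left[OF has_integral_weight] by (rule integral_unique)
    finally show ?thesis
      using Beta_pos[of m] by (simp add: euler_int_def norm_divide field_simps)
  qed
  moreover have "ball z r \<subseteq> cut_plane"
    using r by auto
  ultimately show "\<exists>r>0. \<exists>K. ball z r \<subseteq> cut_plane \<and>
      (\<forall>m. \<forall>w\<in>ball z r. norm (euler_int \<sigma> b m w) \<le> K)"
    using r by blast
qed

section \<open>Power series of Euler's integral\<close>

lemma pochhammer_binomial_sums:
  fixes z a :: complex
  assumes "norm z < 1"
  shows "(\<lambda>n. pochhammer a n / fact n * z ^ n) sums (1 - z) powr (- a)"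
proof -
  have "(- a gchoose n) * (- z) ^ n = pochhammer a n / fact n * z ^ n" for n
  proof -
    have "(- z) ^ n = (-1) ^ n * z ^ n"
      by (metis mult_minus1 power_mult_distrib)
    then show ?thesis
      by (simp add: gbinomial_pochhammer flip: power_mult_distrib)
  qed
  then show ?thesis
    using gen_binomial_complex[of "- z" "- a"] assms by simp
qed

text \<open>The kernel is expanded in its binomial series and integrated term by term. Each power of
  u shifts the first Beta argument, and the Beta quotients become (m + 1)_n / (\<sigma> + 2 +
  m)_n.\<close>

lemma euler_int_sums:
  assumes z: "norm z < 1"
  shows "(\<lambda>n. fps_nth (fps_hypergeo [of_nat (Suc m), b] [of_real (\<sigma> + 2 + m)] 1) n * z ^ n)
           sums euler_int \<sigma> b m z"
proof -
  define w where "w u = u ^ m * (1 - u) powr \<sigma>" for u :: real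
  define f where "f n u = of_real (w u) * (pochhammer b n / fact n * (z * of_real u) ^ n)"
    for n and u :: real
  have w01: "0 \<le> w u" "w u \<le> 1" if "u \<in> {0..1}" for u
    using that \<sigma> unfolding w_def
    by (auto intro!: mult_le_one power_le_one powr_le1)
  have "uniform_limit {0..1} (\<lambda>N u. \<Sum>n<N. f n u) (\<lambda>u. \<Sum>n. f n u) sequentially"
  proof (rule Weierstrass_m_test)
    show "norm (f n u) \<le> norm (pochhammer b n / fact n * z ^ n)" if "u \<in> {0..1}" for n u
    proof -
      have "norm (f n u) = (w u * u ^ n) * norm (pochhammer b n / fact n * z ^ n)"
        using w01[OF that] that by (simp add: f_def norm_mult norm_divide norm_power power_mult_distrib)
      also have "\<dots> \<le> 1 * norm (pochhammer b n / fact n * z ^ n)"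
        using w01[OF that] that by (intro mult_right_mono mult_le_one power_le_one) auto
      finally show ?thesis by simp
    qed
    \<comment> \<open>Convergence at a real point r beyond |z| gives absolute convergence at
      z.\<close>
    obtain r where r: "norm z < r" "r < 1"
      using z dense by blast
    have "summable (\<lambda>n. pochhammer b n / fact n * of_real r ^ n)"
      using r norm_ge_zero[of z] by (intro sums_summable[OF pochhammer_binomial_sums]) (subst norm_of_real, linarith)
    then show "summable (\<lambda>n. norm (pochhammer b n / fact n * z ^ n))"
      using r norm_ge_zero[of z] by (intro powser_insidea[of _ "of_real r"]) auto
  qed
  moreover have "(\<Sum>n. f n u) = of_real (w u) * (1 - z * of_real u) powr (- b)" if "u \<in> {0..1}" for u
  proof -
    have "norm (z * of_real u) < 1"
      using that z mult_left_le[of u "norm z"] by (simp add: norm_mult)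
    from sums_mult[OF pochhammer_binomial_sums[OF this, of b], of "of_real (w u)"]
    show ?thesis by (simp add: f_def sums_iff)
  qed
  ultimately have "uniform_limit {0..1} (\<lambda>N u. \<Sum>n<N. f n u)
      (\<lambda>u. of_real (w u) * (1 - z * of_real u) powr (- b)) sequentially"
    by (subst uniform_limit_cong'[where i = "\<lambda>u. \<Sum>n. f n u"]) auto
  moreover have "continuous_on {0..1} (\<lambda>u. \<Sum>n<N. f n u)" for N
    unfolding f_def w_def
    by (intro continuous_on_sum continuous_on_mult continuous_on_of_real continuous_on_weight continuous_intros)
  ultimately obtain I J where I: "\<And>N. ((\<lambda>u. \<Sum>n<N. f n u) has_integral I N) {0..1}"
      and J: "((\<lambda>u. of_real (w u) * (1 - z * of_real u) powr (- b)) has_integral J) {0..1}"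
      and lim: "I \<longlonglongrightarrow> J"
    by (rule uniform_limit_integral) auto
  have f_int: "(f n has_integral of_real (Beta (real (m + n) + 1) (\<sigma> + 1)) *
       (pochhammer b n / fact n * z ^ n)) {0..1}" for n
  proof -
    have "((\<lambda>u. of_real (u ^ (m + n) * (1 - u) powr \<sigma>) * (pochhammer b n / fact n * z ^ n))
       has_integral of_real (Beta (real (m + n) + 1) (\<sigma> + 1)) * (pochhammer b n / fact n * z ^ n)) {0..1}"
      by (intro has_integral_mult_left has_integral_of_real has_integral_weight)
    also have "(\<lambda>u. of_real (u ^ (m + n) * (1 - u) powr \<sigma>) * (pochhammer b n / fact n * z ^ n)) = f n"
      by (auto simp: f_def w_def fun_eq_iff power_add power_mult_distrib)
    finally show ?thesis .
  qed
  have "I = (\<lambda>N. \<Sum>n<N. of_real (Beta (real (m + n) + 1) (\<sigma> + 1)) * (pochhammer b n / fact n * z ^ n))"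
    by (rule ext, rule has_integral_unique[OF I]) (intro has_integral_sum f_int, auto)
  with lim have "(\<lambda>n. of_real (Beta (real (m + n) + 1) (\<sigma> + 1)) * (pochhammer b n / fact n * z ^ n)) sums J"
    by (simp only: sums_def)
  from sums_divide[OF this, of "of_real (Beta (real m + 1) (\<sigma> + 1))"]
  have "(\<lambda>n. of_real (Beta (real (m + n) + 1) (\<sigma> + 1)) * (pochhammer b n / fact n * z ^ n)
          / of_real (Beta (real m + 1) (\<sigma> + 1))) sums euler_int \<sigma> b m z"
    using integral_unique[OF J] by (simp add: euler_int_def w_def)
  moreover have "of_real (Beta (real (m + n) + 1) (\<sigma> + 1)) * (pochhammer b n / fact n * z ^ n)
          / of_real (Beta (real m + 1) (\<sigma> + 1))
       = fps_nth (fps_hypergeo [of_nat (Suc m), b] [of_real (\<sigma> + 2 + m)] 1) n * z ^ n" for n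
  proof -
    have "Beta (real (m + n) + 1) (\<sigma> + 1) = Beta (real m + 1) (\<sigma> + 1) *
       (pochhammer (real m + 1) n / pochhammer (\<sigma> + 2 + m) n)"
      using Beta_add_nat_left[of "real m + 1" "\<sigma> + 1" n] \<sigma> by (simp add: algebra_simps)
    moreover have "pochhammer (of_nat (Suc m)) n = complex_of_real (pochhammer (real m + 1) n)"
      by (simp flip: pochhammer_of_real add: add.commute)
    moreover have "pochhammer (of_real (\<sigma> + 2 + m)) n = complex_of_real (pochhammer (\<sigma> + 2 + m) n)"
      by (rule pochhammer_of_real)
    ultimately show ?thesis
      using Beta_pos[of m] by (simp add: field_simps del: of_nat_Suc of_real_add)
  qed
  ultimately show ?thesis by simp
qed

lemma euler_int_has_fps_expansion:
  "euler_int \<sigma> b m has_fps_expansion fps_hypergeo [of_nat (Suc m), b] [of_real (\<sigma> + 2 + m)] 1"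
proof (rule has_fps_expansionI)
  have "eventually (\<lambda>z::complex. z \<in> ball 0 1) (nhds 0)"
    by (intro eventually_nhds_in_open) auto
  then show "\<forall>\<^sub>F z in nhds 0. (\<lambda>n. fps_nth (fps_hypergeo [of_nat (Suc m), b] [of_real (\<sigma> + 2 + m)] 1) n * z ^ n)
           sums euler_int \<sigma> b m z"
    by eventually_elim (rule euler_int_sums, auto)
qed

end

subsection \<open>Contiguous relations and the principal branch\<close>

lemma pochhammer_nonzero:
  fixes a :: "'a :: field_char_0"
  assumes "\<And>k. a + of_nat k \<noteq> 0"
  shows "pochhammer a n \<noteq> 0"
  using assms by (simp add: pochhammer_prod)

text \<open>Multiplication by 1 + n / s of the n-th coefficient is the operator 1 + (1 / s) z d/dz,
  and 1 / (s)_n = (1 + n / s) / (s + 1)_n.\<close>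

lemma fps_hypergeo_lower:
  fixes a b s :: "'a :: field_char_0"
  assumes "\<And>n. s + of_nat n \<noteq> 0"
  shows "fps_hypergeo [a, b] [s] 1 = fps_hypergeo [a, b] [s + 1] 1 +
           fps_const (1 / s) * (fps_X * fps_deriv (fps_hypergeo [a, b] [s + 1] 1))"
proof (rule fps_ext)
  fix n
  have "pochhammer s n \<noteq> 0" "pochhammer (s + 1) n \<noteq> 0" "s \<noteq> 0"
    using assms[of 0] assms[of "Suc _"]
    by (auto intro!: pochhammer_nonzero assms simp: add_ac)
  moreover have "s * pochhammer (s + 1) n = pochhammer s n * (s + of_nat n)"
    by (metis mult.commute pochhammer_Suc pochhammer_rec)
  moreover have "(1 + of_nat n / s) / pochhammer (s + 1) n = (s + of_nat n) / (s * pochhammer (s + 1) n)"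
    using calculation by (simp add: field_simps)
  ultimately have "1 / pochhammer s n = (1 + of_nat n / s) / pochhammer (s + 1) n"
    using assms[of n] by simp
  then have "pochhammer a n * pochhammer b n / fact n * (1 / pochhammer s n) =
    pochhammer a n * pochhammer b n / fact n * ((1 + of_nat n / s) / pochhammer (s + 1) n)"
    by simp
  then have "fps_nth (fps_hypergeo [a, b] [s] 1) n
      = (1 + of_nat n / s) * fps_nth (fps_hypergeo [a, b] [s + 1] 1) n"
    by (simp add: mult_ac)
  also have "\<dots> = fps_nth (fps_hypergeo [a, b] [s + 1] 1 +
           fps_const (1 / s) * (fps_X * fps_deriv (fps_hypergeo [a, b] [s + 1] 1))) n"
    by (cases n) (simp_all add: algebra_simps add_divide_distrib del: fps_hypergeo_nth)
  finally show "fps_nth (fps_hypergeo [a, b] [s] 1) n = fps_nth (fps_hypergeo [a, b] [s + 1] 1 +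
           fps_const (1 / s) * (fps_X * fps_deriv (fps_hypergeo [a, b] [s + 1] 1))) n" .
qed

lemma fps_hypergeo_contiguous:
  fixes a b s :: "'a :: field_char_0"
  assumes nz: "\<And>n. s + 1 + of_nat n \<noteq> 0" and "s = 0 \<Longrightarrow> a = 0"
  shows "(fps_const s - fps_const b * fps_X) * fps_hypergeo [a + 1, b] [s + 1] 1 +
           fps_X * (1 - fps_X) * fps_deriv (fps_hypergeo [a + 1, b] [s + 1] 1) =
         fps_const s * fps_hypergeo [a, b] [s] 1" (is "?L = ?R")
proof (rule fps_ext)
  fix n
  let ?G = "fps_hypergeo [a + 1, b] [s + 1] 1"
  have L: "?L = fps_const s * ?G - fps_const b * (fps_X * ?G) + fps_X * fps_deriv ?G
      - fps_X * (fps_X * fps_deriv ?G)"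
    by (simp add: algebra_simps)
  show "fps_nth ?L n = fps_nth ?R n"
  proof (cases n)
    case (Suc k)
    define g where "g = fps_nth ?G k"
    have p: "pochhammer (s + 1) k \<noteq> 0" "s + 1 + of_nat k \<noteq> 0"
      using nz by (auto intro!: pochhammer_nonzero)
    have k: "of_nat k + 1 \<noteq> (0 :: 'a)"
      by (metis of_nat_Suc of_nat_neq_0 add.commute)
    have cancel: "(X * x') * (Y * y') / ((P * x) * (y * f)) * x * y = X * Y / (P * f) * x' * y'"
      if "x \<noteq> 0" "y \<noteq> 0" for X Y P f x y x' y' :: 'a
      using that by simp
    have fact: "fact (Suc k) = (of_nat k + 1) * (fact k :: 'a)"
      by (simp add: algebra_simps)
    \<comment> \<open>Both coefficients at k + 1 are expressed through \<open>g\<close> with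
      denominators cleared, so that the comparison is a polynomial identity; the factor k + 1 is
      cancelled at the end.\<close>
    have "fps_nth ?G (Suc k) * (s + 1 + of_nat k) * (of_nat k + 1) = g * (a + 1 + of_nat k) * (b + of_nat k)"
      using cancel[OF p(2) k] by (simp add: g_def pochhammer_Suc fact del: fact_Suc)
    moreover have "s * fps_nth (fps_hypergeo [a, b] [s] 1) (Suc k) * (of_nat k + 1) = g * a * (b + of_nat k)"
    proof (cases "s = 0")
      case False
      have "pochhammer s (Suc k) = s * pochhammer (s + 1) k"
        "pochhammer a (Suc k) = a * pochhammer (a + 1) k"
        by (simp_all add: pochhammer_rec)
      then show ?thesis
        using cancel[OF False k, of "pochhammer (a + 1) k" a "pochhammer b k" "b + of_nat k"
            "pochhammer (s + 1) k" "fact k"]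
        by (simp add: g_def pochhammer_Suc[of b] fact mult_ac del: fact_Suc)
    qed (use assms in auto)
    moreover have "fps_nth ?L (Suc k) = s * fps_nth ?G (Suc k) - b * g
        + (of_nat k + 1) * fps_nth ?G (Suc k) - of_nat k * g"
      unfolding L g_def by (cases k) (simp_all add: algebra_simps del: fps_hypergeo_nth)
    ultimately have "fps_nth ?L (Suc k) * (of_nat k + 1) = s * fps_nth (fps_hypergeo [a, b] [s] 1) (Suc k) * (of_nat k + 1)"
      by algebra
    then show ?thesis
      using k Suc by (simp del: fps_hypergeo_nth)
  qed (simp add: L)
qed

lemma holomorphic_fps_expansion_unique:
  assumes "f has_fps_expansion F" "g has_fps_expansion F"
    and "f holomorphic_on A" "g holomorphic_on A" "open A" "connected A" "0 \<in> A" "z \<in> A"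
  shows "f z = g z"
proof -
  have "(\<lambda>z. f z - g z) has_fps_expansion 0"
    using has_fps_expansion_diff[OF assms(1,2)] by simp
  then have "f z - g z = 0"
    using assms
    by (intro has_fps_expansion_0_analytic_continuation[where f = "\<lambda>z. f z - g z" and A = A])
       (auto intro: holomorphic_intros)
  then show ?thesis by simp
qed

text \<open>Resolves the choice in \<open>hyp2f1\<close>: the function g shows that a continuation
  exists, so the chosen one is a continuation too, and the identity theorem makes it agree with g
  off the cut.\<close>

lemma hyp2f1_eqI:
  assumes hol: "g holomorphic_on cut_plane"
    and fps: "g has_fps_expansion fps_hypergeo [a, b] [s] 1"
    and z: "z \<in> cut_plane"
  shows "hyp2f1 a b s z = g z"
proof -
  define P where "P f \<longleftrightarrow> f holomorphic_on (- complex_of_real ` {1..}) \<and>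
      (\<forall>z\<in>ball 0 1. f z = eval_fps (fps_hypergeo [a, b] [s] 1) z)" for f
  have eval: "eval_fps (fps_hypergeo [a, b] [s] 1) z = g z" if "z \<in> ball 0 1" for z
    using fps that holomorphic_on_subset[OF hol unit_ball_subset_cut_plane]
    by (intro has_fps_expansion_imp_eval_fps_eq[where r = 1]) auto
  have "P g"
    using hol eval by (simp add: P_def cut_plane_def)
  then have "P (SOME f. P f)"
    by (rule someI[of P g])
  then have "P (hyp2f1 a b s)"
    by (simp add: hyp2f1_def P_def)
  then have hol': "hyp2f1 a b s holomorphic_on cut_plane"
    and eq: "\<And>w. w \<in> ball 0 1 \<Longrightarrow> hyp2f1 a b s w = g w"
    using eval by (simp_all add: P_def cut_plane_def)
  show ?thesis
    by (rule analytic_continuation_open[of "ball 0 1" cut_plane "hyp2f1 a b s" g])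
       (use hol hol' eq z open_cut_plane connected_cut_plane unit_ball_subset_cut_plane in auto)
qed

section \<open>The Gauss functions 2F1(1 + m, b; s + m) on the cut plane\<close>

context
  fixes s :: real and b :: complex
  assumes s: "s > 0"
begin

abbreviation gauss :: "nat \<Rightarrow> complex \<Rightarrow> complex" where
  "gauss m \<equiv> hyp2f1 (1 + of_nat m) b (of_real s + of_nat m)"

abbreviation gauss_fps :: "nat \<Rightarrow> complex fps" where
  "gauss_fps m \<equiv> fps_hypergeo [1 + of_nat m, b] [of_real s + of_nat m] 1"

lemma add_of_nat_nonzero: "of_real s + (of_nat m :: complex) \<noteq> 0"
proof -
  have "complex_of_real (s + real m) \<noteq> 0"
    using s by (subst of_real_eq_0_iff) linarith
  then show ?thesis by simp
qed

text \<open>All three facts come from one explicit model \<open>f0\<close> of the continuation: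
  Euler's integral with lower parameter s + m + 2, lowered twice.\<close>

lemma
  shows gauss_holomorphic: "gauss m holomorphic_on cut_plane"
    and gauss_has_fps_expansion: "gauss m has_fps_expansion gauss_fps m"
    and gauss_locally_bounded: "locally_bounded_family gauss cut_plane"
proof -
  define \<sigma> where "\<sigma> m = of_real s + (of_nat m :: complex)" for m
  define lower where "lower a f m z = f m z + a m * (z * deriv (f m) z)"
    for a :: "nat \<Rightarrow> complex" and f m z
  \<comment> \<open>\<open>f1\<close> has lower parameter s + m + 1 and \<open>f0\<close> has s +
    m.\<close>
  define f1 where "f1 = lower (\<lambda>m. 1 / (\<sigma> m + 1)) (euler_int s b)"
  define f0 where "f0 = lower (\<lambda>m. 1 / \<sigma> m) f1"
  \<comment> \<open>The factors of both lowering steps are bounded by 1 / s for every m, as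
    \<open>locally_bounded_family_lower\<close> requires.\<close>
  have bound: "norm (1 / \<sigma> m) \<le> 1 / s" "norm (1 / (\<sigma> m + 1)) \<le> 1 / s" for m
  proof -
    have "\<sigma> m = of_real (s + m)" "\<sigma> m + 1 = of_real (s + m + 1)"
      by (simp_all add: \<sigma>_def)
    then have "norm (\<sigma> m) = s + m" "norm (\<sigma> m + 1) = s + m + 1"
      using s by (simp_all only: norm_of_real)
    then show "norm (1 / \<sigma> m) \<le> 1 / s" "norm (1 / (\<sigma> m + 1)) \<le> 1 / s"
      using s by (simp_all add: norm_divide field_simps)
  qed
  have hol_lower: "lower a f m holomorphic_on cut_plane" if "f m holomorphic_on cut_plane" for a f m
    unfolding lower_def using that open_cut_plane by (intro holomorphic_intros) auto
  have fps_lower: "lower a f m has_fps_expansion F + fps_const (a m) * (fps_X * fps_deriv F)"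
    if "f m has_fps_expansion F" for a f m F
    unfolding lower_def using that by (intro fps_expansion_intros) auto
  have hol1: "f1 m holomorphic_on cut_plane" for m
    unfolding f1_def by (intro hol_lower euler_int_holomorphic s)
  have hol0: "f0 m holomorphic_on cut_plane" for m
    unfolding f0_def by (intro hol_lower hol1)
  have fps2: "euler_int s b m has_fps_expansion
      fps_hypergeo [1 + of_nat m, b] [\<sigma> m + 1 + 1] 1" for m
    using euler_int_has_fps_expansion[OF s, of b m] by (simp add: \<sigma>_def algebra_simps)
  have nz: "\<sigma> m + of_nat k \<noteq> 0" "\<sigma> m + 1 + of_nat k \<noteq> 0" for m k
    using add_of_nat_nonzero[of "m + k"] add_of_nat_nonzero[of "m + 1 + k"]
    by (simp_all add: \<sigma>_def algebra_simps)
  have fps1: "f1 m has_fps_expansion fps_hypergeo [1 + of_nat m, b] [\<sigma> m + 1] 1" for m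
    unfolding f1_def by (subst fps_hypergeo_lower) (use nz fps_lower fps2 in blast)+
  have fps0: "f0 m has_fps_expansion gauss_fps m" for m
    unfolding f0_def \<sigma>_def[symmetric]
    by (subst fps_hypergeo_lower) (use nz fps_lower fps1 in blast)+
  have lb: "locally_bounded_family f0 cut_plane"
    unfolding f0_def f1_def lower_def
    by (intro locally_bounded_family_lower[where A = "1 / s"] bound euler_int_locally_bounded
        euler_int_holomorphic s hol1[unfolded f1_def lower_def])
  have eq: "gauss m z = f0 m z" if "z \<in> cut_plane" for m z
    using hol0 fps0 that by (rule hyp2f1_eqI)
  show "gauss m holomorphic_on cut_plane"
    using hol0[of m] eq by (simp cong: holomorphic_cong)
  have "\<forall>\<^sub>F z in nhds 0. z \<in> cut_plane"
    by (intro eventually_nhds_in_open open_cut_plane zero_in_cut_plane)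
  then have "\<forall>\<^sub>F z in nhds 0. gauss m z = f0 m z"
    by eventually_elim (rule eq)
  then show "gauss m has_fps_expansion gauss_fps m"
    using fps0[of m] has_fps_expansion_cong by blast
  show "locally_bounded_family gauss cut_plane"
    using lb eq unfolding locally_bounded_family_def by (metis (no_types, lifting) subsetD)
qed

lemma gauss_sums:
  assumes "norm z < 1"
  shows "(\<lambda>n. fps_nth (gauss_fps m) n * z ^ n) sums gauss m z"
  using assms gauss_holomorphic unit_ball_subset_cut_plane
  by (intro has_fps_expansion_imp_sums_complex[OF gauss_has_fps_expansion, where r = 1])
     (auto intro: holomorphic_on_subset simp: one_ereal_def)

text \<open>The formal identity holds near 0 and extends to the cut plane by the identity theorem.
  It expresses \<open>gauss m\<close> through its successor and the derivative of the
  latter.\<close>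

lemma gauss_contiguous:
  assumes "z \<in> cut_plane"
  shows "(of_real s + of_nat m - b * z) * gauss (Suc m) z + z * (1 - z) * deriv (gauss (Suc m)) z
           = (of_real s + of_nat m) * gauss m z"
proof -
  let ?\<sigma> = "of_real s + of_nat m :: complex"
  have *: "fps_const ?\<sigma> * gauss_fps m = (fps_const ?\<sigma> - fps_const b * fps_X) * gauss_fps (Suc m)
      + fps_X * (1 - fps_X) * fps_deriv (gauss_fps (Suc m))"
    using fps_hypergeo_contiguous[of ?\<sigma> "1 + of_nat m" b] add_of_nat_nonzero[of "m + 1 + _"]
      add_of_nat_nonzero[of m]
    by (simp add: algebra_simps)
  have 1: "(\<lambda>z. (?\<sigma> - b * z) * gauss (Suc m) z + z * (1 - z) * deriv (gauss (Suc m)) z)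
      has_fps_expansion fps_const ?\<sigma> * gauss_fps m"
    unfolding * by (intro fps_expansion_intros gauss_has_fps_expansion)
  have 2: "(\<lambda>z. ?\<sigma> * gauss m z) has_fps_expansion fps_const ?\<sigma> * gauss_fps m"
    by (intro fps_expansion_intros gauss_has_fps_expansion)
  show ?thesis
    by (rule holomorphic_fps_expansion_unique[where A = cut_plane, OF 1 2])
      (use assms open_cut_plane connected_cut_plane zero_in_cut_plane gauss_holomorphic
        gauss_holomorphic[of "Suc m"] in
      \<open>auto intro!: holomorphic_intros\<close>)
qed

text \<open>The contiguous relation one index below m = 0: the upper parameter 0 reduces the
  neighbouring function to the constant 1, which is the source of the inhomogeneous term s -
  1.\<close>

lemma gauss_contiguous_0:
  assumes "z \<in> cut_plane"
  shows "(of_real s - 1 - b * z) * gauss 0 z + z * (1 - z) * deriv (gauss 0) z = of_real s - 1"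
proof -
  let ?\<sigma> = "of_real s - 1 :: complex"
  have "fps_hypergeo [0, b] [?\<sigma>] 1 = 1"
    by (rule fps_ext) (simp add: pochhammer_0_left)
  then have *: "fps_const ?\<sigma> = (fps_const ?\<sigma> - fps_const b * fps_X) * gauss_fps 0
      + fps_X * (1 - fps_X) * fps_deriv (gauss_fps 0)"
    using fps_hypergeo_contiguous[of ?\<sigma> 0 b] add_of_nat_nonzero by simp
  have 1: "(\<lambda>z. (?\<sigma> - b * z) * gauss 0 z + z * (1 - z) * deriv (gauss 0) z)
      has_fps_expansion fps_const ?\<sigma>"
    by (subst *) (intro fps_expansion_intros gauss_has_fps_expansion)
  show ?thesis
    by (rule holomorphic_fps_expansion_unique[where A = cut_plane, OF 1 has_fps_expansion_const])
      (use assms open_cut_plane connected_cut_plane zero_in_cut_plane gauss_holomorphic[of 0] in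
      \<open>auto intro!: holomorphic_intros\<close>)
qed

end

subsection \<open>The differential equation of the Appell series\<close>

text \<open>The ratio test with the ratios given as factors \<open>q n\<close>, so that terms of the
  series may vanish, as Pochhammer symbols do.\<close>

lemma summable_ratio_limit:
  fixes f :: "nat \<Rightarrow> 'a :: {banach, real_normed_div_algebra}"
  assumes f: "\<And>n. f (Suc n) = q n * f n" and q: "q \<longlonglongrightarrow> L" and L: "norm L < 1"
  shows "summable (\<lambda>n. norm (f n))"
proof -
  obtain \<rho> where \<rho>: "norm L < \<rho>" "\<rho> < 1"
    using L dense by blast
  have "\<forall>\<^sub>F n in sequentially. norm (q n) < \<rho>"
    using tendsto_norm[OF q] \<rho>(1) by (rule order_tendstoD)
  then obtain N where N: "\<And>n. n \<ge> N \<Longrightarrow> norm (q n) < \<rho>"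
    by (auto simp: eventually_at_top_linorder)
  show ?thesis
    by (rule summable_ratio_test[OF \<rho>(2), of N])
       (use N in \<open>auto simp: f norm_mult intro!: mult_right_mono intro: less_imp_le\<close>)
qed

lemma of_nat_ratio_tendsto:
  fixes a b :: "'a :: real_normed_field"
  shows "(\<lambda>n. (a + of_nat n) / (b + of_nat n)) \<longlonglongrightarrow> 1"
proof -
  have lim: "(\<lambda>n. c / of_nat n) \<longlonglongrightarrow> 0" for c :: 'a
    using tendsto_mult[OF tendsto_const[of c] lim_inverse_n] by (simp add: divide_inverse)
  have "(\<lambda>n. (a / of_nat n + 1) / (b / of_nat n + 1)) \<longlonglongrightarrow> (0 + 1) / (0 + 1)"
    by (intro tendsto_intros lim) auto
  moreover have "\<forall>\<^sub>F n in sequentially.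
      (a / of_nat n + 1) / (b / of_nat n + 1) = (a + of_nat n) / (b + of_nat n)"
    using eventually_gt_at_top[of 0]
  proof eventually_elim
    case (elim n)
    then have "a / of_nat n + 1 = (a + of_nat n) / of_nat n"
      "b / of_nat n + 1 = (b + of_nat n) / of_nat n"
      by (simp_all add: field_simps)
    with elim show ?case by simp
  qed
  ultimately show ?thesis
    by (auto dest: Lim_transform_eventually)
qed

text \<open>The coefficient of the Appell series for first parameter 1, where (1)_m cancels against
  m!.\<close>

definition weight :: "real \<Rightarrow> complex \<Rightarrow> nat \<Rightarrow> complex" where
  "weight s \<gamma> m = pochhammer \<gamma> m / pochhammer (of_real s) m"

definition mobius :: "real \<Rightarrow> complex \<Rightarrow> complex" where
  "mobius c t = t * (1 - of_real c) / (1 - of_real c * t)"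

text \<open>If Y(t) = r >= 1, then t (1 + c (r - 1)) = r. But |t| < 1 and c |t| <= 1 make the
  modulus of the left side less than 1 + (r - 1) = r.\<close>

lemma
  assumes c: "c > 0" and "t \<in> ball (0 :: complex) (min 1 (1 / c))"
  shows one_minus_nonzero: "1 - of_real c * t \<noteq> 0"
    and mobius_in_cut_plane: "mobius c t \<in> cut_plane"
proof -
  have t: "norm t < min 1 (1 / c)"
    using assms by simp
  have ct: "norm (of_real c * t) < 1"
    using t c by (simp add: norm_mult field_simps)
  then show nz: "1 - of_real c * t \<noteq> 0"
    by auto
  show "mobius c t \<in> cut_plane"
    unfolding cut_plane_def mobius_def
  proof
    assume "t * (1 - of_real c) / (1 - of_real c * t) \<in> complex_of_real ` {1..}"
    then obtain r where r: "t * (1 - of_real c) / (1 - of_real c * t) = of_real r" "r \<ge> 1"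
      by auto
    then have eq: "t * of_real (1 + c * (r - 1)) = of_real r"
      using nz by (simp add: field_simps)
    have pos: "1 + c * (r - 1) > 0"
      using c r by (simp add: add_pos_nonneg)
    have "norm (t * of_real (1 + c * (r - 1))) = norm t * (1 + c * (r - 1))"
      using pos by (simp only: norm_mult norm_of_real abs_of_pos)
    then have n: "norm t * (1 + c * (r - 1)) = r"
      unfolding eq using r by simp
    have "norm t * (c * (r - 1)) \<le> r - 1"
    proof -
      have "norm t * c \<le> 1"
        using ct c by (simp add: norm_mult mult.commute)
      from mult_right_mono[OF this, of "r - 1"] r show ?thesis
        by (simp add: mult_ac)
    qed
    moreover have "norm t < 1"
      using t by simp
    ultimately show False
      using n by (simp add: distrib_left)
  qed
qed

definition appell_term :: "real \<Rightarrow> real \<Rightarrow> complex \<Rightarrow> complex \<Rightarrow> nat \<Rightarrow> complex \<Rightarrow> complex" where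
  "appell_term s c b \<gamma> m t =
     weight s \<gamma> m * hyp2f1 (1 + of_nat m) b (of_real s + of_nat m) (mobius c t) * t ^ m"

text \<open>The t-derivative of \<open>appell_term\<close> by the chain and product rules. At m = 0
  the truncated exponent \<open>m - 1\<close> is multiplied by 0.\<close>

definition appell_term' :: "real \<Rightarrow> real \<Rightarrow> complex \<Rightarrow> complex \<Rightarrow> nat \<Rightarrow> complex \<Rightarrow> complex" where
  "appell_term' s c b \<gamma> m t = weight s \<gamma> m *
     (deriv (hyp2f1 (1 + of_nat m) b (of_real s + of_nat m)) (mobius c t)
          * ((1 - of_real c) / (1 - of_real c * t)\<^sup>2) * t ^ m
      + hyp2f1 (1 + of_nat m) b (of_real s + of_nat m) (mobius c t) * (of_nat m * t ^ (m - 1)))"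

section \<open>Termwise analysis of the series H\<close>

context
  fixes s c :: real and b \<gamma> :: complex
  assumes s: "s > 0" and c: "c > 0"
begin

lemma weight_Suc: "weight s \<gamma> (Suc m) * (of_real s + of_nat m) = weight s \<gamma> m * (\<gamma> + of_nat m)"
  using add_of_nat_nonzero[OF s, of m] by (simp add: weight_def pochhammer_Suc)

lemma weight_ratio: "weight s \<gamma> (Suc m) = (\<gamma> + of_nat m) / (of_real s + of_nat m) * weight s \<gamma> m"
  using weight_Suc[of m] add_of_nat_nonzero[OF s, of m] by (simp add: field_simps)

lemma summable_weight:
  assumes "norm t < 1"
  shows "summable (\<lambda>m. norm (weight s \<gamma> m * t ^ m))"
proof (rule summable_ratio_limit)
  show "weight s \<gamma> (Suc m) * t ^ Suc m = ((\<gamma> + of_nat m) / (of_real s + of_nat m) * t) * (weight s \<gamma> m * t ^ m)" for m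
    by (simp add: weight_ratio)
  show "(\<lambda>m. (\<gamma> + of_nat m) / (of_real s + of_nat m) * t) \<longlonglongrightarrow> 1 * t"
    by (intro tendsto_intros of_nat_ratio_tendsto)
qed (use assms in simp)

text \<open>Controls the boundary term of the telescoping sum in \<open>appell_ode\<close>. The
  ratio is arranged without division by \<gamma> + m, which may be 0.\<close>

lemma weight_times_index_tendsto_0:
  assumes "norm t < 1"
  shows "(\<lambda>m. weight s \<gamma> m * (\<gamma> + of_nat m) * t ^ m) \<longlonglongrightarrow> 0"
proof -
  have "summable (\<lambda>m. norm (weight s \<gamma> m * (\<gamma> + of_nat m) * t ^ m))"
  proof (rule summable_ratio_limit)
    have cancel: "A / S * W * B * (t * T) = B / S * t * (W * A * T)" for A B S W T :: complex
      by simp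
    have Suc: "\<gamma> + 1 + of_nat m = \<gamma> + of_nat (Suc m)" for m
      by simp
    show "weight s \<gamma> (Suc m) * (\<gamma> + of_nat (Suc m)) * t ^ Suc m
        = ((\<gamma> + 1 + of_nat m) / (of_real s + of_nat m) * t) * (weight s \<gamma> m * (\<gamma> + of_nat m) * t ^ m)" for m
      unfolding Suc weight_ratio[of m] power_Suc by (rule cancel)
    show "(\<lambda>m. (\<gamma> + 1 + of_nat m) / (of_real s + of_nat m) * t) \<longlonglongrightarrow> 1 * t"
      by (intro tendsto_intros of_nat_ratio_tendsto)
  qed (use assms in simp)
  then show ?thesis
    by (rule summable_LIMSEQ_zero[OF summable_norm_cancel])
qed

abbreviation "disc \<equiv> ball (0 :: complex) (min 1 (1 / c))"

lemma mobius_has_field_derivative: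
  assumes "t \<in> disc"
  shows "(mobius c has_field_derivative (1 - of_real c) / (1 - of_real c * t)\<^sup>2) (at t)"
  unfolding mobius_def[abs_def] using one_minus_nonzero[OF c assms]
  by (auto intro!: derivative_eq_intros simp: power2_eq_square field_simps)

lemma appell_term_has_field_derivative:
  assumes "t \<in> disc"
  shows "(appell_term s c b \<gamma> m has_field_derivative appell_term' s c b \<gamma> m t) (at t)"
proof -
  have "(hyp2f1 (1 + of_nat m) b (of_real s + of_nat m) has_field_derivative
      deriv (hyp2f1 (1 + of_nat m) b (of_real s + of_nat m)) (mobius c t)) (at (mobius c t))"
    using gauss_holomorphic[OF s] open_cut_plane mobius_in_cut_plane[OF c assms]
    by (rule holomorphic_derivI)
  from DERIV_chain2[OF this mobius_has_field_derivative[OF assms]]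
  have "((\<lambda>t. hyp2f1 (1 + of_nat m) b (of_real s + of_nat m) (mobius c t)) has_field_derivative
      deriv (hyp2f1 (1 + of_nat m) b (of_real s + of_nat m)) (mobius c t)
        * ((1 - of_real c) / (1 - of_real c * t)\<^sup>2)) (at t)" .
  moreover have "((\<lambda>t. t ^ m) has_field_derivative of_nat m * t ^ (m - 1)) (at t)"
    using DERIV_power[OF DERIV_ident, of m] by simp
  ultimately have "((\<lambda>t. weight s \<gamma> m * (hyp2f1 (1 + of_nat m) b (of_real s + of_nat m) (mobius c t) * t ^ m))
      has_field_derivative weight s \<gamma> m * (deriv (hyp2f1 (1 + of_nat m) b (of_real s + of_nat m)) (mobius c t)
          * ((1 - of_real c) / (1 - of_real c * t)\<^sup>2) * t ^ m
      + of_nat m * t ^ (m - 1) * hyp2f1 (1 + of_nat m) b (of_real s + of_nat m) (mobius c t))) (at t)"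
    by (intro DERIV_cmult DERIV_mult)
  then show ?thesis
    unfolding appell_term_def[abs_def] appell_term'_def by (simp only: mult_ac)
qed

text \<open>Local domination, in the form demanded by the theorem on termwise differentiation: near
  t the Gauss factors share a bound K, and |y| <= \<rho> < 1, so K |weight| \<rho>^m is a
  majorant.\<close>

lemma appell_term_bounded:
  assumes "t \<in> disc"
  shows "\<exists>d h. 0 < d \<and> summable h \<and>
    (\<forall>\<^sub>F m in sequentially. \<forall>y\<in>ball t d \<inter> disc. norm (appell_term s c b \<gamma> m y) \<le> h m)"
proof -
  obtain r K where r: "r > 0" and K: "\<And>m w. w \<in> ball (mobius c t) r \<Longrightarrow>
      norm (hyp2f1 (1 + of_nat m) b (of_real s + of_nat m) w) \<le> K"
    using locally_bounded_familyE[OF gauss_locally_bounded[OF s] mobius_in_cut_plane[OF c assms]] by metis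
  have "isCont (mobius c) t"
    using mobius_has_field_derivative[OF assms] by (rule DERIV_isCont)
  then obtain d1 where d1: "d1 > 0" "\<And>y. dist y t < d1 \<Longrightarrow> dist (mobius c y) (mobius c t) < r"
    using r unfolding continuous_at_eps_delta by metis
  \<comment> \<open>The midpoint of |t| and 1. The radius \<open>d\<close> keeps y within |y| <=
    \<rho> and its image under \<open>mobius c\<close> within the ball on which K is valid.\<close>
  define \<rho> where "\<rho> = (norm t + 1) / 2"
  have \<rho>: "norm t < \<rho>" "\<rho> < 1" "\<rho> \<ge> 0"
    using assms by (auto simp: \<rho>_def intro: add_nonneg_nonneg)
  define d where "d = min d1 (\<rho> - norm t)"
  have K0: "K \<ge> 0"
    using K[of "mobius c t" 0] r norm_ge_zero order_trans by (metis centre_in_ball)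
  have "norm (appell_term s c b \<gamma> m y) \<le> K * norm (weight s \<gamma> m * of_real \<rho> ^ m)" if "y \<in> ball t d" for m y
  proof -
    have "norm y \<le> \<rho>"
      using that norm_triangle_sub[of y t] by (simp add: d_def dist_norm norm_minus_commute)
    then have "norm y ^ m \<le> \<rho> ^ m"
      by (intro power_mono) auto
    moreover have "norm (hyp2f1 (1 + of_nat m) b (of_real s + of_nat m) (mobius c y)) \<le> K"
      using that d1(2)[of y] by (intro K) (simp add: d_def dist_commute)
    ultimately have "norm (hyp2f1 (1 + of_nat m) b (of_real s + of_nat m) (mobius c y))
        * norm y ^ m \<le> K * \<rho> ^ m"
      using K0 by (intro mult_mono) auto
    from mult_left_mono[OF this norm_ge_zero[of "weight s \<gamma> m"]] show ?thesis
      using \<rho> by (simp add: appell_term_def norm_mult norm_power mult_ac)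
  qed
  moreover have "summable (\<lambda>m. K * norm (weight s \<gamma> m * of_real \<rho> ^ m))"
    using \<rho> by (intro summable_mult summable_weight) auto
  moreover have "d > 0"
    using d1 \<rho> by (simp add: d_def)
  ultimately show ?thesis
    by (intro exI[of _ d] exI[of _ "\<lambda>m. K * norm (weight s \<gamma> m * of_real \<rho> ^ m)"])
       (auto intro!: always_eventually)
qed

text \<open>The contiguous relations turn the differential equation into a telescoping sum.\<close>

lemma appell_ode:
  assumes t: "t \<in> disc"
  shows "(\<lambda>m. t * (1 - t) * appell_term' s c b \<gamma> m t
      + (of_real s - 1 - \<gamma> * t - b * mobius c t) * appell_term s c b \<gamma> m t) sums (of_real s - 1)"
proof -
  define g where "g m = hyp2f1 (1 + of_nat m) b (of_real s + of_nat m) (mobius c t)" for m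
  define g' where "g' m = deriv (hyp2f1 (1 + of_nat m) b (of_real s + of_nat m)) (mobius c t)" for m
  \<comment> \<open>The m-th term will be v m - v (m + 1). Here v 0 is the right side of the
    relation at m = 0, and v (k + 1) is what the k-th term leaves over.\<close>
  define v where "v m = (case m of 0 \<Rightarrow> of_real s - 1
      | Suc k \<Rightarrow> weight s \<gamma> k * (\<gamma> + of_nat k) * g k * t ^ Suc k)" for m
  have cut: "mobius c t \<in> cut_plane"
    using t by (rule mobius_in_cut_plane[OF c])
  \<comment> \<open>Since 1 - Y = (1 - t) / (1 - c t), one gets t (1 - t) Y' = Y (1 - Y), which
    turns the t-derivative into the one of the contiguous relations.\<close>
  have "1 - x / u = (u - x) / u" if "u \<noteq> 0" for x u :: complex
    using that by (simp add: diff_divide_distrib)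
  from this[OF one_minus_nonzero[OF c t]]
  have "1 - mobius c t = (1 - of_real c * t - t * (1 - of_real c)) / (1 - of_real c * t)"
    unfolding mobius_def .
  also have "1 - of_real c * t - t * (1 - of_real c) = 1 - t"
    by (simp add: right_diff_distrib)
  finally have arg': "t * (1 - t) * ((1 - of_real c) / (1 - of_real c * t)\<^sup>2) = mobius c t * (1 - mobius c t)"
    by (simp add: mobius_def power2_eq_square)
  have v_Suc: "v (Suc m) = weight s \<gamma> m * (\<gamma> + of_nat m) * g m * (t * t ^ m)" for m
    by (simp add: v_def)
  have alg: "t * (1 - t) * (W * (G' * D * T + G * T')) + E * (W * G * T)
      = W * (G' * (t * (1 - t) * D) * T + (1 - t) * G * (t * T') + E * (G * T))"
    for W G G' D T T' E :: complex
    by algebra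
  \<comment> \<open>The parts -\<gamma> t and -m t, the latter from differentiating t^m, combine
    into -(\<gamma> + m) t, the factor of v (m + 1).\<close>
  have alg': "W * (G' * A * T + (1 - t) * G * (M * T) + (S - 1 - \<gamma> * t - B) * (G * T))
      = W * T * ((S + M - 1 - B) * G + A * G') - W * (\<gamma> + M) * G * (t * T)"
    for W G G' A M S B T :: complex
    by algebra
  have pow: "t * (of_nat m * t ^ (m - 1)) = of_nat m * t ^ m" for m
    by (cases m) auto
  have telescope: "t * (1 - t) * appell_term' s c b \<gamma> m t + (of_real s - 1 - \<gamma> * t - b * mobius c t) * appell_term s c b \<gamma> m t
      = v m - v (Suc m)" for m
  proof -
    have "t * (1 - t) * appell_term' s c b \<gamma> m t + (of_real s - 1 - \<gamma> * t - b * mobius c t) * appell_term s c b \<gamma> m t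
      = weight s \<gamma> m * (g' m * (t * (1 - t) * ((1 - of_real c) / (1 - of_real c * t)\<^sup>2)) * t ^ m
          + (1 - t) * g m * (t * (of_nat m * t ^ (m - 1)))
          + (of_real s - 1 - \<gamma> * t - b * mobius c t) * (g m * t ^ m))"
      unfolding appell_term'_def appell_term_def g_def g'_def by (rule alg)
    also have "\<dots> = weight s \<gamma> m * t ^ m * ((of_real s + of_nat m - 1 - b * mobius c t) * g m
          + mobius c t * (1 - mobius c t) * g' m) - v (Suc m)"
      unfolding pow arg' v_Suc by (rule alg')
    also have "weight s \<gamma> m * t ^ m * ((of_real s + of_nat m - 1 - b * mobius c t) * g m
          + mobius c t * (1 - mobius c t) * g' m) = v m"
    \<comment> \<open>For m = k + 1 the relation produces (s + k) g k, and \<open>weight_Suc\<close>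
      trades the factor s + k for \<gamma> + k.\<close>
    proof (cases m)
      case 0
      have "(of_real s - 1 - b * mobius c t) * g 0 + mobius c t * (1 - mobius c t) * g' 0 = of_real s - 1"
        using gauss_contiguous_0[OF s cut] by (simp add: g_def g'_def)
      then show ?thesis
        using 0 by (simp add: v_def weight_def)
    next
      case (Suc k)
      have "(of_real s + of_nat k - b * mobius c t) * g (Suc k) + mobius c t * (1 - mobius c t) * g' (Suc k)
          = (of_real s + of_nat k) * g k"
        using gauss_contiguous[OF s cut] by (simp only: g_def g'_def)
      then have "weight s \<gamma> m * t ^ m * ((of_real s + of_nat m - 1 - b * mobius c t) * g m
          + mobius c t * (1 - mobius c t) * g' m) = (weight s \<gamma> (Suc k) * (of_real s + of_nat k)) * g k * t ^ Suc k"
        by (simp add: Suc)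
      then show ?thesis
        unfolding weight_Suc using Suc by (simp add: v_def)
    qed
    finally show ?thesis .
  qed
  \<comment> \<open>At the fixed point Y(t) the Gauss values are bounded in m, so the decay comes
    from the weights.\<close>
  have "v \<longlonglongrightarrow> 0"
  proof -
    obtain K where K: "\<And>m. norm (g m) \<le> K"
      using locally_bounded_familyE[OF gauss_locally_bounded[OF s] cut] unfolding g_def
      by (metis centre_in_ball)
    have "norm t < 1"
      using t by simp
    then have "(\<lambda>m. weight s \<gamma> m * (\<gamma> + of_nat m) * t ^ m) \<longlonglongrightarrow> 0"
      by (rule weight_times_index_tendsto_0)
    then have "(\<lambda>m. norm (weight s \<gamma> m * (\<gamma> + of_nat m) * t ^ m) * (K * norm t)) \<longlonglongrightarrow> 0"
      by (intro tendsto_mult_left_zero tendsto_norm_zero)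
    moreover have "norm (v (Suc m)) \<le> norm (weight s \<gamma> m * (\<gamma> + of_nat m) * t ^ m) * (K * norm t)" for m
    proof -
      have "v (Suc m) = (weight s \<gamma> m * (\<gamma> + of_nat m) * t ^ m) * (g m * t)"
        by (simp add: v_def)
      moreover have "norm (g m * t) \<le> K * norm t"
        unfolding norm_mult by (intro mult_right_mono K) auto
      ultimately show ?thesis
        by (metis mult_left_mono norm_ge_zero norm_mult)
    qed
    ultimately have "(\<lambda>m. v (Suc m)) \<longlonglongrightarrow> 0"
      by (rule Lim_null_comparison[OF always_eventually[OF allI], rotated])
    then show ?thesis
      by (rule LIMSEQ_imp_Suc)
  qed
  from telescope_sums'[OF this] show ?thesis
    unfolding telescope by (simp add: v_def)
qed

end

subsection \<open>The double series and the generating function\<close>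

text \<open>The one-variable majorant for the double series; the extra factor m + 1 absorbs the
  growth of (1)_k / (s)_k.\<close>

lemma summable_pochhammer_fact:
  fixes a z :: complex
  assumes "norm z < 1"
  shows "summable (\<lambda>m. norm (of_nat (Suc m) * (pochhammer a m / fact m) * z ^ m))"
proof (rule summable_ratio_limit)
  let ?q = "\<lambda>m. (2 + of_nat m) / (1 + of_nat m) * ((a + of_nat m) / (1 + of_nat m)) * z"
  have cancel: "B * (P * A / (M * Q)) * (z * T) = B / M * (A / M) * z * (M * (P / Q) * T)"
    if "M \<noteq> 0" for A B M P Q T :: complex
    using that by simp
  have nat: "of_nat (Suc m) = 1 + (of_nat m :: complex)" "of_nat (Suc (Suc m)) = 2 + (of_nat m :: complex)"
    and nz: "1 + (of_nat m :: complex) \<noteq> 0" for m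
    using of_nat_neq_0[where 'a = complex, of m] by simp_all
  show "of_nat (Suc (Suc m)) * (pochhammer a (Suc m) / fact (Suc m)) * z ^ Suc m
      = ?q m * (of_nat (Suc m) * (pochhammer a m / fact m) * z ^ m)" for m
    unfolding nat(2) unfolding pochhammer_Suc fact_Suc power_Suc nat(1) using nz by (rule cancel)
  show "?q \<longlonglongrightarrow> 1 * 1 * z"
    by (intro tendsto_intros of_nat_ratio_tendsto)
qed (use assms in simp)

text \<open>For k >= 1 one has (s)_k >= s (k - 1)!, hence k! <= (k / s) (s)_k. The larger constant
  also covers k = 0.\<close>

lemma fact_le_pochhammer:
  fixes s :: real
  assumes s: "s > 0"
  shows "fact k \<le> (1 + 1 / s) * (1 + real k) * pochhammer s k"
proof (cases k)
  case (Suc j)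
  have "fact (Suc j) \<le> real (Suc j) / s * pochhammer s (Suc j)"
  proof (induction j)
    case 0
    then show ?case using s by simp
  next
    case (Suc j)
    have "fact (Suc (Suc j)) = real (Suc (Suc j)) * fact (Suc j)"
      by (simp only: fact_Suc)
    also have "\<dots> \<le> real (Suc (Suc j)) * (real (Suc j) / s * pochhammer s (Suc j))"
      using Suc.IH by (rule mult_left_mono) auto
    also have "\<dots> = real (Suc (Suc j)) / s * (pochhammer s (Suc j) * real (Suc j))"
      by simp
    also have "\<dots> \<le> real (Suc (Suc j)) / s * (pochhammer s (Suc j) * (s + real (Suc j)))"
      using s by (intro mult_left_mono) (auto simp: pochhammer_nonneg)
    finally show ?case by (simp only: pochhammer_Suc[of s "Suc j"])
  qed
  also have "\<dots> \<le> (1 + 1 / s) * (1 + real (Suc j)) * pochhammer s (Suc j)"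
  proof (rule mult_right_mono)
    have "real (Suc j) / s \<le> (1 / s) * (1 + real (Suc j))"
      using s by (simp add: field_simps)
    also have "\<dots> \<le> (1 + 1 / s) * (1 + real (Suc j))"
      by (intro mult_right_mono) auto
    finally show "real (Suc j) / s \<le> (1 + 1 / s) * (1 + real (Suc j))" .
  qed (use s in \<open>simp add: pochhammer_nonneg\<close>)
  finally show ?thesis
    using Suc by simp
qed (use s in simp)

text \<open>The quotient (1)_(m+n) / (s)_(m+n) couples the two indices. A linear bound on it
  separates them, and the double series is dominated by a product of two single series.\<close>

lemma appell_F1_summable:
  fixes s :: real and \<gamma> b X Y :: complex
  assumes s: "s > 0" and X: "norm X < 1" and Y: "norm Y < 1"
  shows "(\<lambda>(m, n). pochhammer 1 (m + n) * pochhammer \<gamma> m * pochhammer b n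
            / pochhammer (of_real s) (m + n) * (X ^ m / fact m) * (Y ^ n / fact n)) summable_on UNIV"
proof -
  define A where "A m = norm (of_nat (Suc m) * (pochhammer \<gamma> m / fact m) * X ^ m)" for m
  define B where "B n = norm (of_nat (Suc n) * (pochhammer b n / fact n) * Y ^ n)" for n
  have AB0: "A m \<ge> 0" "B n \<ge> 0" for m n
    by (simp_all add: A_def B_def)
  have sum: "A summable_on UNIV" "B summable_on UNIV"
    using summable_pochhammer_fact[OF X] summable_pochhammer_fact[OF Y]
    by (auto intro!: norm_summable_imp_summable_on simp: A_def B_def)
  have "(\<lambda>p. norm (case p of (m, n) \<Rightarrow> A m * B n)) summable_on Sigma UNIV (\<lambda>_. UNIV)"
    by (rule Infinite_Sum.abs_summable_on_Sigma_iff[THEN iffD2])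
      (use sum AB0 in \<open>auto simp: infsum_cmult_right' abs_mult infsum_nonneg
        intro!: summable_on_cmult_right summable_on_cmult_left\<close>)
  then have "(\<lambda>p. (1 + 1 / s) * (case p of (m, n) \<Rightarrow> A m * B n)) summable_on UNIV"
    using AB0 by (intro summable_on_cmult_right) (simp add: case_prod_unfold)
  then show ?thesis
  proof (rule Infinite_Sum.abs_summable_summable[OF Infinite_Sum.abs_summable_on_comparison_test'])
    fix p :: "nat \<times> nat"
    obtain m n where p: "p = (m, n)"
      by (cases p)
    have "norm (pochhammer 1 (m + n) / pochhammer (of_real s) (m + n) :: complex)
        = fact (m + n) / pochhammer s (m + n)"
      using s by (simp add: norm_divide pochhammer_of_real pochhammer_fact[symmetric] pochhammer_nonneg)
    also have "\<dots> \<le> (1 + 1 / s) * (1 + real (m + n))"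
      using fact_le_pochhammer[OF s, of "m + n"] pochhammer_pos[OF s] by (simp add: pos_divide_le_eq)
    \<comment> \<open>The separation: 1 + m + n <= (m + 1)(n + 1).\<close>
    also have "\<dots> \<le> (1 + 1 / s) * (real (Suc m) * real (Suc n))"
      using s by (intro mult_left_mono) (auto simp: algebra_simps)
    finally have "norm (pochhammer 1 (m + n) / pochhammer (of_real s) (m + n) :: complex)
       * norm (pochhammer \<gamma> m / fact m * X ^ m * (pochhammer b n / fact n * Y ^ n))
       \<le> (1 + 1 / s) * (real (Suc m) * real (Suc n)) *
          norm (pochhammer \<gamma> m / fact m * X ^ m * (pochhammer b n / fact n * Y ^ n))"
      by (rule mult_right_mono) simp
    also have "\<dots> = (1 + 1 / s) * (A m * B n)"
      by (simp only: A_def B_def norm_mult norm_of_nat mult_ac)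
    finally show "norm (case p of (m, n) \<Rightarrow> pochhammer 1 (m + n) * pochhammer \<gamma> m * pochhammer b n
            / pochhammer (of_real s) (m + n) * (X ^ m / fact m) * (Y ^ n / fact n))
          \<le> (1 + 1 / s) * (case p of (m, n) \<Rightarrow> A m * B n)"
      by (simp add: p norm_divide norm_mult norm_power mult_ac)
  qed
qed

text \<open>Unites the two branches of \<open>appell_F1\<close>, so that |Y| < 1 need not be
  distinguished later. On the bidisc the double sum is iterated, with the inner sum a Gauss
  series.\<close>

lemma appell_F1_eq_suminf:
  fixes s :: real and \<gamma> b X Y :: complex
  assumes s: "s > 0" and X: "norm X < 1"
  shows "appell_F1 1 \<gamma> b (of_real s) X Y =
     (\<Sum>m. weight s \<gamma> m * hyp2f1 (1 + of_nat m) b (of_real s + of_nat m) Y * X ^ m)"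
proof (cases "norm Y < 1")
  case Y: True
  define f where "f = (\<lambda>(m, n). pochhammer 1 (m + n) * pochhammer \<gamma> m * pochhammer b n
            / pochhammer (of_real s) (m + n) * (X ^ m / fact m) * (Y ^ n / fact n))"
  have f: "f summable_on UNIV \<times> UNIV"
    using appell_F1_summable[OF s X Y] by (simp add: f_def)
  have inner: "(\<Sum>\<^sub>\<infinity>n. f (m, n)) = weight s \<gamma> m * hyp2f1 (1 + of_nat m) b (of_real s + of_nat m) Y * X ^ m" for m
  proof (rule sums_unique2)
    have "(\<lambda>n. f (m, n)) summable_on UNIV"
      using f by (rule summable_on_SigmaD1[of "\<lambda>m n. f (m, n)", simplified]) auto
    then show "(\<lambda>n. f (m, n)) sums (\<Sum>\<^sub>\<infinity>n. f (m, n))"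
      by (intro has_sum_imp_sums has_sum_infsum)
    \<comment> \<open>Splits (1)_(m+n) = m! (1 + m)_n and (s)_(m+n) = (s)_m (s + m)_n.\<close>
    have "f (m, n) = weight s \<gamma> m * X ^ m * (fps_nth (gauss_fps s b m) n * Y ^ n)" for n
    proof -
      have "pochhammer 1 (m + n) = fact m * (pochhammer (1 + of_nat m) n :: complex)"
        by (simp add: pochhammer_product'[of _ m n] pochhammer_fact)
      then show ?thesis
        by (simp add: f_def weight_def pochhammer_product'[of "of_real s" m n])
    qed
    then show "(\<lambda>n. f (m, n)) sums (weight s \<gamma> m * hyp2f1 (1 + of_nat m) b (of_real s + of_nat m) Y * X ^ m)"
      using sums_mult[OF gauss_sums[OF s Y, where b = b and m = m], of "weight s \<gamma> m * X ^ m"]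
      by (simp add: mult_ac del: fps_hypergeo_nth)
  qed
  have "(\<lambda>m. \<Sum>\<^sub>\<infinity>n. f (m, n)) summable_on UNIV"
    using f by (rule summable_on_Sigma_banach[of "\<lambda>m n. f (m, n)", simplified])
  then have "(\<Sum>\<^sub>\<infinity>m. \<Sum>\<^sub>\<infinity>n. f (m, n)) = (\<Sum>m. \<Sum>\<^sub>\<infinity>n. f (m, n))"
    by (intro sums_unique has_sum_imp_sums has_sum_infsum)
  moreover have "(\<Sum>\<^sub>\<infinity>m. \<Sum>\<^sub>\<infinity>n. f (m, n)) = infsum f UNIV"
    using infsum_Sigma_banach[OF f] by simp
  moreover have "appell_F1 1 \<gamma> b (of_real s) X Y = infsum f UNIV"
    using X Y by (simp add: appell_F1_def f_def)
  ultimately show ?thesis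
    unfolding inner by simp
next
  case False
  then have "appell_F1 1 \<gamma> b (of_real s) X Y = (\<Sum>m. pochhammer 1 m * pochhammer \<gamma> m / pochhammer (of_real s) m
            * hyp2f1 (1 + of_nat m) b (of_real s + of_nat m) Y * (X ^ m / fact m))"
    by (simp add: appell_F1_def)
  then show ?thesis
    by (simp add: weight_def pochhammer_fact[symmetric] mult_ac)
qed

text \<open>The differential equation gives the Taylor coefficients of the right side the same
  recurrence and initial values as those on the left. Holomorphy on the whole disc then gives
  convergence there.\<close>

lemma assoc_meixner_generating_function:
  fixes x \<beta> c \<gamma> :: real and t :: complex
  assumes c: "c > 0" and s: "\<gamma> + \<beta> > 0" and t: "norm t < min 1 (1 / c)"
  shows "(\<lambda>n. (of_real c * t) ^ n / pochhammer (of_real (\<gamma> + \<beta>)) n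
              * of_real (assoc_meixner n x \<beta> c \<gamma>)) sums
         (1 / (1 - of_real c * t) *
            (\<Sum>m. appell_term (\<gamma> + \<beta>) c (of_real (- x)) (of_real \<gamma>) m t))"
proof -
  define s where "s = \<gamma> + \<beta>"
  define S where "S = complex_of_real s"
  define C where "C = complex_of_real c"
  define b where "b = complex_of_real (- x)"
  define \<Gamma> where "\<Gamma> = complex_of_real \<gamma>"
  have s0: "s > 0"
    using s by (simp add: s_def)
  let ?D = "ball (0 :: complex) (min 1 (1 / c))"
  have zero: "0 \<in> ?D"
    using c by simp
  obtain g g' where g: "\<forall>t\<in>?D. (\<lambda>m. appell_term s c b \<Gamma> m t) sums g t \<and>
      (\<lambda>m. appell_term' s c b \<Gamma> m t) sums g' t \<and> (g has_field_derivative g' t) (at t)"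
    using series_and_derivative_comparison_local[OF open_ball
        appell_term_has_field_derivative[OF s0 c] appell_term_bounded[OF s0 c]] by metis
  have ode: "t * (1 - t) * g' t + (S - 1 - \<Gamma> * t - b * mobius c t) * g t = S - 1" if "t \<in> ?D" for t
  proof (rule sums_unique2)
    show "(\<lambda>m. t * (1 - t) * appell_term' s c b \<Gamma> m t + (S - 1 - \<Gamma> * t - b * mobius c t) * appell_term s c b \<Gamma> m t)
        sums (t * (1 - t) * g' t + (S - 1 - \<Gamma> * t - b * mobius c t) * g t)"
      using g that by (intro sums_add sums_mult) auto
    show "(\<lambda>m. t * (1 - t) * appell_term' s c b \<Gamma> m t + (S - 1 - \<Gamma> * t - b * mobius c t) * appell_term s c b \<Gamma> m t)
        sums (S - 1)"
      unfolding S_def using s0 c that by (rule appell_ode)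
  qed
  define G where "G t = g t / (1 - C * t)" for t
  have nz: "1 - C * t \<noteq> 0" if "t \<in> ?D" for t
    unfolding C_def using one_minus_nonzero[OF c that] .
  have G_deriv: "(G has_field_derivative (g' t + C * G t) / (1 - C * t)) (at t)" if "t \<in> ?D" for t
  proof -
    have "((\<lambda>t. 1 - C * t) has_field_derivative - C) (at t)"
      by (auto intro!: derivative_eq_intros)
    from DERIV_divide[OF _ this nz[OF that]] g that
    have "(G has_field_derivative (g' t * (1 - C * t) - g t * - C) / ((1 - C * t) * (1 - C * t))) (at t)"
      unfolding G_def[abs_def] by blast
    moreover have "(g' t * (1 - C * t) - g t * - C) / ((1 - C * t) * (1 - C * t))
        = (g' t + C * G t) / (1 - C * t)"
      using nz[OF that] by (simp add: G_def divide_simps)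
    ultimately show ?thesis by simp
  qed
  have G_hol: "G holomorphic_on ?D"
    using G_deriv by (intro holomorphic_onI) (auto simp: field_differentiable_def intro: has_field_derivative_at_within)
  \<comment> \<open>Inserting g = (1 - C t) G, g' = (1 - C t) G' - C G and Y g = t (1 - C) G leaves
    polynomial coefficients, so the equation carries over to power series.\<close>
  have G_ode: "t * (1 - t) * ((1 - C * t) * deriv G t - C * G t) + (S - 1 - \<Gamma> * t) * ((1 - C * t) * G t)
      - b * (1 - C) * (t * G t) = S - 1" if "t \<in> ?D" for t
  proof -
    have "deriv G t = (g' t + C * G t) / (1 - C * t)"
      by (rule DERIV_imp_deriv[OF G_deriv[OF that]])
    then have "(1 - C * t) * deriv G t - C * G t = g' t"
      using nz[OF that] by simp
    moreover have "(1 - C * t) * G t = g t"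
      using nz[OF that] by (simp add: G_def)
    moreover have "b * (1 - C) * (t * G t) = b * mobius c t * g t"
      by (simp add: G_def mobius_def C_def[symmetric])
    ultimately show ?thesis
      using ode[OF that] by (simp only: left_diff_distrib) (simp add: algebra_simps)
  qed
  define F where "F = fps_expansion G 0"
  have "G analytic_on {0}"
    using G_hol zero analytic_on_def analytic_at open_ball by blast
  then have F: "G has_fps_expansion F"
    unfolding F_def by (rule analytic_at_imp_has_fps_expansion_0)
  let ?L = "fps_X * (1 - fps_X) * ((1 - fps_const C * fps_X) * fps_deriv F - fps_const C * F)
      + (fps_const (S - 1) - fps_const \<Gamma> * fps_X) * ((1 - fps_const C * fps_X) * F)
      - fps_const (b * (1 - C)) * (fps_X * F)"
  have "(\<lambda>t. t * (1 - t) * ((1 - C * t) * deriv G t - C * G t) + (S - 1 - \<Gamma> * t) * ((1 - C * t) * G t)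
      - b * (1 - C) * (t * G t)) has_fps_expansion ?L"
    by (intro fps_expansion_intros F)
  moreover have "\<forall>\<^sub>F t in nhds 0. t \<in> ?D"
    using zero by (intro eventually_nhds_in_open) auto
  then have "\<forall>\<^sub>F t in nhds 0. t * (1 - t) * ((1 - C * t) * deriv G t - C * G t)
      + (S - 1 - \<Gamma> * t) * ((1 - C * t) * G t) - b * (1 - C) * (t * G t) = S - 1"
    by eventually_elim (rule G_ode)
  ultimately have "(\<lambda>_. S - 1) has_fps_expansion ?L"
    by (simp only: has_fps_expansion_cong[OF _ refl])
  then have L: "?L = fps_const (S - 1)"
    by (rule fps_expansion_unique_complex) (rule has_fps_expansion_const)
  \<comment> \<open>Sorted by powers of \<open>fps_X\<close> in front of \<open>F\<close> and
    \<open>fps_X * fps_deriv F\<close>, whose n-th coefficient is n times that of \<open>F\<close>;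
    the recurrence can then be read off.\<close>
  have expand: "?L = fps_X * fps_deriv F - fps_const (1 + C) * (fps_X * (fps_X * fps_deriv F))
      + fps_const C * (fps_X * (fps_X * (fps_X * fps_deriv F))) + fps_const (S - 1) * F
      - fps_const (C * S + \<Gamma> + b * (1 - C)) * (fps_X * F) + fps_const (C * (1 + \<Gamma>)) * (fps_X * (fps_X * F))"
  proof -
    have eqs: "fps_const (1 + C) = 1 + fps_const C" "fps_const (S - 1) = fps_const S - 1"
      "fps_const (C * S + \<Gamma> + b * (1 - C)) = fps_const C * fps_const S + fps_const \<Gamma> + fps_const (b * (1 - C))"
      "fps_const (C * (1 + \<Gamma>)) = fps_const C * (1 + fps_const \<Gamma>)"
      by (simp_all add: fps_const_add[symmetric] fps_const_mult[symmetric] fps_const_sub[symmetric]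
           del: fps_const_add fps_const_mult fps_const_sub)
    show ?thesis
      unfolding eqs by (simp only: algebra_simps mult_1_left mult_1_right)
  qed
  \<comment> \<open>The constant coefficient of the equation reads (S - 1) F_0 = S - 1 and leaves
    F_0 open when S = 1. So F_0 is taken from the series, of which only the term m = 0 survives at t
    = 0.\<close>
  have F0: "fps_nth F 0 = 1"
  proof -
    have "(\<lambda>m. appell_term s c b \<Gamma> m 0) sums appell_term s c b \<Gamma> 0 0"
      by (rule sums_single[of 0 "\<lambda>m. appell_term s c b \<Gamma> m 0", THEN sums_cong[THEN iffD1, rotated]])
         (auto simp: appell_term_def)
    moreover have "appell_term s c b \<Gamma> 0 0 = 1"
      using has_fps_expansion_imp_0_eq_fps_nth_0[OF gauss_has_fps_expansion[OF s0, of 0 b]]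
      by (simp add: appell_term_def weight_def mobius_def)
    ultimately have "g 0 = 1"
      using g zero sums_unique2 by metis
    then show ?thesis
      using has_fps_expansion_imp_0_eq_fps_nth_0[OF F] by (simp add: G_def)
  qed
  have F1: "S * fps_nth F 1 = C * S + \<Gamma> + b * (1 - C)"
    using arg_cong[OF L[unfolded expand], of "\<lambda>f. fps_nth f 1"] F0 by (simp add: algebra_simps)
  have F2: "(S + of_nat (Suc k)) * fps_nth F (Suc (Suc k)) =
      ((1 + C) * of_nat (Suc k) + C * S + \<Gamma> + b * (1 - C)) * fps_nth F (Suc k)
      - C * (of_nat (Suc k) + \<Gamma>) * fps_nth F k" for k
  proof -
    have "of_nat (Suc (Suc k)) * fps_nth F (Suc (Suc k)) - (1 + C) * (of_nat (Suc k) * fps_nth F (Suc k))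
        + C * (of_nat k * fps_nth F k) + (S - 1) * fps_nth F (Suc (Suc k))
        - (C * S + \<Gamma> + b * (1 - C)) * fps_nth F (Suc k) + C * (1 + \<Gamma>) * fps_nth F k = 0"
      using arg_cong[OF L[unfolded expand], of "\<lambda>f. fps_nth f (Suc (Suc k))"]
      by (cases k) (simp_all del: of_nat_Suc)
    then show ?thesis by (simp add: algebra_simps)
  qed
  define u where "u n = c ^ n / pochhammer s n * assoc_meixner n x \<beta> c \<gamma>" for n
  have pos: "s + real n > 0" "pochhammer s n > 0" for n
    using s0 by (auto intro: pochhammer_pos add_pos_nonneg)
  have u1: "s * u 1 = (c - 1) * x + (c + 1) * \<gamma> + \<beta> * c"
    using s0 c by (simp add: u_def)
  \<comment> \<open>In the recurrence at n = k + 1 the factor n + \<gamma> + \<beta> - 1 is s + k,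
    which cancels against the last factor of (s)_(k+1).\<close>
  have u2: "(s + real (Suc k)) * u (Suc (Suc k)) =
      ((c - 1) * x + (c + 1) * (real (Suc k) + \<gamma>) + \<beta> * c) * u (Suc k) - c * (real (Suc k) + \<gamma>) * u k" for k
  proof -
    define A where "A = (c - 1) * x + (c + 1) * (real (Suc k) + \<gamma>) + \<beta> * c"
    define M where "M n = assoc_meixner n x \<beta> c \<gamma>" for n
    define p where "p = pochhammer s k"
    define B where "B = real (Suc k) + \<gamma>"
    have "M (Suc (Suc k)) = (A * M (Suc k) - B * (s + real k) * M k) / c"
      by (simp add: M_def A_def B_def s_def algebra_simps)
    then have rec: "c * M (Suc (Suc k)) = A * M (Suc k) - B * (s + real k) * M k"
      using c by simp
    have p: "p \<noteq> 0" "s + real k \<noteq> 0" "s + real (Suc k) \<noteq> 0"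
      using pos(1)[of k] pos(1)[of "Suc k"] pos(2)[of k] by (auto simp: p_def)
    have "(s + real (Suc k)) * u (Suc (Suc k))
        = c * c ^ k / (p * (s + real k)) * (c * M (Suc (Suc k)))"
      using p by (simp add: u_def M_def[symmetric] p_def[symmetric] pochhammer_Suc
          del: of_nat_Suc assoc_meixner.simps)
    also have "\<dots> = A * u (Suc k) - c * B * u k"
      unfolding rec right_diff_distrib
      using p by (simp add: u_def M_def[symmetric] p_def[symmetric] pochhammer_Suc mult_ac)
    finally have "(s + real (Suc k)) * u (Suc (Suc k)) = A * u (Suc k) - c * B * u k" .
    then show ?thesis by (simp only: A_def B_def)
  qed
  \<comment> \<open>Two consecutive coefficients are carried through the induction because the
    recurrence has three terms. With b = -x, the constant C S + \<Gamma> + b (1 - C) is (c - 1) x +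
    (c + 1) \<gamma> + \<beta> c.\<close>
  have F_u: "fps_nth F n = of_real (u n) \<and> fps_nth F (Suc n) = of_real (u (Suc n))" for n
  proof (induction n)
    case 0
    have "S * fps_nth F 1 = S * of_real (u 1)"
      unfolding F1 unfolding S_def of_real_mult[symmetric] u1
      by (simp add: S_def C_def b_def \<Gamma>_def s_def algebra_simps)
    then show ?case
      using F0 s0 by (simp add: S_def u_def)
  next
    case (Suc k)
    have "(S + of_nat (Suc k)) * fps_nth F (Suc (Suc k)) = of_real ((s + real (Suc k)) * u (Suc (Suc k)))"
      unfolding F2 u2 using Suc.IH
      by (simp add: S_def C_def b_def \<Gamma>_def s_def algebra_simps)
    also have "\<dots> = (S + of_nat (Suc k)) * of_real (u (Suc (Suc k)))"
      by (simp add: S_def)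
    finally have "fps_nth F (Suc (Suc k)) = of_real (u (Suc (Suc k)))"
      using add_of_nat_nonzero[OF s0, of "Suc k"] unfolding S_def by (simp only: mult_cancel_left) simp
    then show ?case using Suc.IH by simp
  qed
  have "(\<lambda>n. fps_nth F n * t ^ n) sums G t"
    using F G_hol t by (intro has_fps_expansion_imp_sums_complex[where r = "ereal (min 1 (1 / c))"]) auto
  moreover have "fps_nth F n * t ^ n = (of_real c * t) ^ n / pochhammer (of_real (\<gamma> + \<beta>)) n
              * of_real (assoc_meixner n x \<beta> c \<gamma>)" for n
    using F_u[of n] unfolding s_def[symmetric] pochhammer_of_real
    by (simp add: u_def power_mult_distrib)
  moreover have "G t = 1 / (1 - of_real c * t) *
            (\<Sum>m. appell_term (\<gamma> + \<beta>) c (of_real (- x)) (of_real \<gamma>) m t)"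
    using g t by (simp add: G_def C_def s_def b_def \<Gamma>_def sums_iff)
  ultimately show ?thesis by simp
qed

theorem theorem2p1:
  fixes x \<beta> c \<gamma> :: real
  assumes "c > 0" and "c \<noteq> 1"
  shows "(\<gamma> \<ge> 0 \<and> \<gamma> + \<beta> > 0 \<longrightarrow>
           (\<forall>t::complex. norm t < min 1 (1 / c) \<longrightarrow>
             (\<lambda>n. (of_real c * t) ^ n / pochhammer (of_real (\<gamma> + \<beta>)) n
                    * of_real (assoc_meixner n x \<beta> c \<gamma>))
             sums (1 / (1 - of_real c * t)
                    * appell_F1 1 (of_real \<gamma>) (of_real (- x)) (of_real (\<gamma> + \<beta>))
                        t (t * (1 - of_real c) / (1 - of_real c * t)))))
       \<and> (\<beta> > 0 \<longrightarrow>
           (\<forall>t::complex. norm t < min 1 c \<longrightarrow>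
             (\<lambda>n. t ^ n / pochhammer (of_real \<beta>) n * of_real (meixner n x \<beta> c))
             sums (1 / (1 - t)
                    * hyp2f1 1 (of_real (- x)) (of_real \<beta>)
                        (t * (1 - of_real c) / (of_real c * (1 - t))))))"
proof (intro conjI impI allI)
  fix t :: complex
  assume \<gamma>\<beta>: "\<gamma> \<ge> 0 \<and> \<gamma> + \<beta> > 0" and t: "norm t < min 1 (1 / c)"
  have "appell_F1 1 (of_real \<gamma>) (of_real (- x)) (of_real (\<gamma> + \<beta>))
          t (t * (1 - of_real c) / (1 - of_real c * t))
      = (\<Sum>m. appell_term (\<gamma> + \<beta>) c (of_real (- x)) (of_real \<gamma>) m t)"
    using \<gamma>\<beta> t by (subst appell_F1_eq_suminf) (simp_all add: appell_term_def[abs_def] mobius_def)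
  then show "(\<lambda>n. (of_real c * t) ^ n / pochhammer (of_real (\<gamma> + \<beta>)) n
                    * of_real (assoc_meixner n x \<beta> c \<gamma>))
             sums (1 / (1 - of_real c * t)
                    * appell_F1 1 (of_real \<gamma>) (of_real (- x)) (of_real (\<gamma> + \<beta>))
                        t (t * (1 - of_real c) / (1 - of_real c * t)))"
    using assoc_meixner_generating_function[OF assms(1) _ t] \<gamma>\<beta> by simp
next
  fix t :: complex
  assume \<beta>: "\<beta> > 0" and t: "norm t < min 1 c"
  \<comment> \<open>The Meixner case is the first formula at \<gamma> = 0 with t replaced by t / c;
    this carries |t| < min 1 c into the disc of the first formula.\<close>
  define \<tau> where "\<tau> = t / of_real c"
  have c\<tau>: "of_real c * \<tau> = t"
    using assms by (simp add: \<tau>_def)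
  have \<tau>: "norm \<tau> < min 1 (1 / c)"
    using t assms(1) by (simp add: \<tau>_def norm_divide field_simps)
  \<comment> \<open>Since (0)_m = 0 for m >= 1, the Appell series reduces to its first Gauss
    function.\<close>
  have "(\<Sum>m. appell_term \<beta> c (of_real (- x)) 0 m \<tau>) = (\<Sum>m\<in>{0}. appell_term \<beta> c (of_real (- x)) 0 m \<tau>)"
    by (rule suminf_finite) (auto simp: appell_term_def weight_def pochhammer_0_left)
  also have "\<dots> = hyp2f1 1 (of_real (- x)) (of_real \<beta>) (t * (1 - of_real c) / (of_real c * (1 - t)))"
  proof -
    have "mobius c \<tau> = t * (1 - of_real c) / (of_real c * (1 - t))"
      unfolding mobius_def c\<tau> by (simp add: \<tau>_def)
    then show ?thesis by (simp add: appell_term_def weight_def)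
  qed
  finally show "(\<lambda>n. t ^ n / pochhammer (of_real \<beta>) n * of_real (meixner n x \<beta> c))
             sums (1 / (1 - t)
                    * hyp2f1 1 (of_real (- x)) (of_real \<beta>)
                        (t * (1 - of_real c) / (of_real c * (1 - t))))"
    using assoc_meixner_generating_function[OF assms(1) _ \<tau>, of 0 \<beta> x] \<beta>
    by (simp add: c\<tau> meixner_def)
qed

end
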